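(* Let $\phi:\mathbb{C}\times\mathbb{H}\to\mathbb{C}$ be a (not necessarily holomorphic) function satisfying the same transformation laws as Jacobi forms of weight $k$ and index $m$ ($k,m\in\mathbb{N}$) on the full modular group $\mathrm{SL}_2(\mathbb{Z})$ without multiplier, and having an expansion of the form $$\phi(z;\tau)=:\sum_{n}\chi_n(\overline{z};\tau)\,z^n .$$ Then $$ \rho_n(\tau) := \sum_{j \geq 0} \frac{\left(\frac{\pi^2 m }{3}E_2(\tau)\right)^j}{j!}\,\chi_{n-2j}(0;\tau) $$ transforms modular of weight $k+n$, i.e. $\rho_n\left(\frac{a\tau+b}{c\tau+d}\right)=(c\tau+d)^{k+n}\rho_n(\tau)$ for all $\left(\begin{smallmatrix}a&b\\c&d\end{smallmatrix}\right)\in\mathrm{SL}_2(\mathbb{Z})$.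
   Context: Notation: $\mathbb{H}$ is the complex upper half-plane, $z\in\mathbb{C}$, $\tau\in\mathbb{H}$, $q=e^{2\pi i\tau}$, and $E_2(\tau)=1-24\sum_{n=1}^\infty\sigma_1(n)q^n$, where $\sigma_1(n)$ is the sum of the positive divisors of $n$. The transformation laws of a Jacobi form of weight $k$ and index $m$ on $\mathrm{SL}_2(\mathbb{Z})$ are: for all $\left(\begin{smallmatrix}a&b\\c&d\end{smallmatrix}\right)\in\mathrm{SL}_2(\mathbb{Z})$ and $\lambda,\mu\in\mathbb{Z}$, (1) $\phi\left(\frac{z}{c\tau+d};\frac{a\tau+b}{c\tau+d}\right)=(c\tau+d)^k e^{\frac{2\pi i m c z^2}{c\tau+d}}\phi(z;\tau)$; (2) $\phi(z+\lambda\tau+\mu;\tau)=e^{-2\pi i m(\lambda^2\tau+2\lambda z)}\phi(z;\tau)$. The coefficients $\chi_n$ are also allowed to be non-holomorphic in $\tau$.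
   Formalization: The expansion is taken near z=0 for each τ, with coefficients χ_n holomorphic in the variable z̄, only finitely many negative n, and locally uniform convergence for z≠0; for arbitrary functions χ_n of z̄ the claim fails (φ=0, χ_0=−z, χ_1=1). *)

theory Defs
  imports "HOL-Complex_Analysis.Complex_Analysis"
begin

definition upper_half_plane :: "complex set" (\<open>\<H>\<close>) where
  "\<H> = {\<tau>. Im \<tau> > 0}"

text \<open>An element of \<open>SL\<^sub>2(\<int>)\<close> is given by its integer entries.\<close>

definition SL2Z :: "(int \<times> int \<times> int \<times> int) set" where
  "SL2Z = {(a, b, c, d). a * d - b * c = 1}"

definition aut_factor :: "int \<Rightarrow> int \<Rightarrow> complex \<Rightarrow> complex" where
  "aut_factor c d \<tau> = of_int c * \<tau> + of_int d"

definition moebius :: "int \<Rightarrow> int \<Rightarrow> int \<Rightarrow> int \<Rightarrow> complex \<Rightarrow> complex" where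
  "moebius a b c d \<tau> = (of_int a * \<tau> + of_int b) / (of_int c * \<tau> + of_int d)"

text \<open>Only the behaviour under the group is required; there is no holomorphy or growth condition.\<close>

definition transforms_modular :: "int \<Rightarrow> (complex \<Rightarrow> complex) \<Rightarrow> bool" where
  "transforms_modular w f \<longleftrightarrow>
     (\<forall>(a, b, c, d) \<in> SL2Z. \<forall>\<tau> \<in> \<H>.
        f (moebius a b c d \<tau>) = aut_factor c d \<tau> powi w * f \<tau>)"

definition transforms_jacobi :: "nat \<Rightarrow> nat \<Rightarrow> (complex \<Rightarrow> complex \<Rightarrow> complex) \<Rightarrow> bool" where
  "transforms_jacobi k m \<phi> \<longleftrightarrow>
     (\<forall>(a, b, c, d) \<in> SL2Z. \<forall>z. \<forall>\<tau> \<in> \<H>.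
        \<phi> (z / aut_factor c d \<tau>) (moebius a b c d \<tau>) =
          aut_factor c d \<tau> ^ k
          * exp (2 * of_real pi * \<i> * of_nat m * of_int c * z\<^sup>2 / aut_factor c d \<tau>) * \<phi> z \<tau>) \<and>
     (\<forall>(l::int) (u::int). \<forall>z. \<forall>\<tau> \<in> \<H>.
        \<phi> (z + of_int l * \<tau> + of_int u) \<tau> =
          exp (- 2 * of_real pi * \<i> * of_nat m * ((of_int l)\<^sup>2 * \<tau> + 2 * of_int l * z)) * \<phi> z \<tau>)"

definition sigma1 :: "nat \<Rightarrow> nat" where
  "sigma1 n = \<Sum>{d. d dvd n}"

definition E2 :: "complex \<Rightarrow> complex" where
  "E2 \<tau> = 1 - 24 * (\<Sum>n. of_nat (sigma1 (Suc n)) * exp (2 * of_real pi * \<i> * \<tau>) ^ Suc n)"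

text \<open>
  The expansion \<open>f z = (\<Sum>n. c n (cnj z) * z powi n)\<close> about \<open>z = 0\<close>. The coefficients are
  holomorphic functions of the conjugate variable near \<open>0\<close>, and the series converges uniformly
  on compact subsets of a punctured disc. Without holomorphy of the coefficients the expansion
  would not determine them (any function of \<open>z\<close> is a function of \<open>cnj z\<close>), and so the values
  \<open>c n 0\<close> would be meaningless. Finitely many negative exponents are admitted; a Taylor-type
  expansion is the case where \<open>c n\<close> vanishes for all \<open>n < 0\<close>.
\<close>

definition has_conj_expansion :: "(complex \<Rightarrow> complex) \<Rightarrow> (int \<Rightarrow> complex \<Rightarrow> complex) \<Rightarrow> bool" where
  "has_conj_expansion f c \<longleftrightarrow>
     (\<exists>(r::real) (N::int). r > 0 \<and>
        (\<forall>n. c n holomorphic_on ball 0 r) \<and>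
        (\<forall>n<N. \<forall>w\<in>ball 0 r. c n w = 0) \<and>
        (\<forall>K. compact K \<and> K \<subseteq> ball 0 r - {0} \<longrightarrow>
           uniform_limit K (\<lambda>M z. \<Sum>n\<in>{N..<N + int M}. c n (cnj z) * z powi n) f sequentially))"

text \<open>
  For coefficients as in \<^const>\<open>has_conj_expansion\<close> only finitely many terms of this sum are nonzero.
\<close>

definition rho :: "nat \<Rightarrow> (int \<Rightarrow> complex \<Rightarrow> complex \<Rightarrow> complex) \<Rightarrow> int \<Rightarrow> complex \<Rightarrow> complex" where
  "rho m chi n \<tau> =
     (\<Sum>j. (of_real pi ^ 2 * of_nat m / 3 * E2 \<tau>) ^ j / fact j * chi (n - 2 * int j) 0 \<tau>)"

end

(*
  Completing the exponential removes the index. The function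
    psi(z; tau) = exp (pi^2 m / 3 * E2(tau) * z^2) * phi(z; tau)
  has, in its expansion in powers of z, exactly the coefficients rho_n(tau) at conjugate variable 0,
  and the anomaly 6 c (c tau + d) / (pi i) in the transformation law of E2 cancels the factor
  exp (2 pi i m c z^2 / (c tau + d)), so that psi(z / J; gamma tau) = J^k psi(z; tau) with
  J = c tau + d. Comparing the coefficients of z^n gives the theorem; this needs that the values at
  0 of antiholomorphic coefficients are determined by the function, which follows from the maximum
  principle on small circles.

  The law of E2 comes from E2(tau) = 1 + 6 / pi^2 * sum_{m >= 1} sum_n (m tau + n)^(-2): exchanging
  the two sums realises tau -> -1/tau up to an explicitly computable defect.
*)
theory Submission
  imports Defs
begin

subsection \<open>Partial fractions of the cotangent\<close>

text \<open>The constant pi^2 m / 3 is forced: multiplied by the anomaly 6 c J / (pi i) of E2 and by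
  (z / J)^2 it gives -2 pi i m c z^2 / J, which is the negative of the exponent in the Jacobi law.
  The defect in the exchange of the two lattice sums is the limit of a telescoping sequence of
  cotangents taken ever deeper in the lower half-plane, where the cotangent tends to i. This is why
  partial fractions of the cotangent are needed besides those of its derivative. On the Jacobi side
  the obstacle is that z and its conjugate are not independent. The expansion is known only where
  the argument w of the coefficients equals \<open>cnj z\<close>, and only as a uniform limit of
  partial sums, while multiplying it by an exponential series asks for absolute convergence.
  Negative exponents are removed by dividing by \<open>z powi N\<close>; the lowest exponents at
  \<tau> and at its image may differ, so N has to be admissible for both.\<close>

lemma not_nonpos_Ints_if_Im: "Im z \<noteq> 0 \<Longrightarrow> z \<notin> \<int>\<^sub>\<le>\<^sub>0"
  by (auto elim!: nonpos_Ints_cases)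

lemma sin_pi_neq_0:
  assumes "Im z \<noteq> 0"
  shows "sin (of_real pi * z) \<noteq> 0"
proof
  assume "sin (of_real pi * z) = 0"
  then obtain n :: int where "of_real pi * z = of_real pi * of_int n"
    by (auto simp: sin_eq_0 mult_ac)
  hence "z = of_int n"
    by (subst (asm) mult_left_cancel) auto
  thus False
    using assms by simp
qed

text \<open>Logarithmic derivative of \<open>rGamma z * rGamma (1 - z) = sin (pi * z) / pi\<close>;
  the reciprocal Gamma function is used because it is entire.\<close>

lemma Digamma_reflection:
  fixes z :: complex
  assumes "Im z \<noteq> 0"
  shows "Digamma (1 - z) - Digamma z = of_real pi * cot (of_real pi * z)"
proof -
  have z: "z \<notin> \<int>\<^sub>\<le>\<^sub>0" "1 - z \<notin> \<int>\<^sub>\<le>\<^sub>0"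
    by (rule not_nonpos_Ints_if_Im, use assms in simp)+
  have "((\<lambda>z. rGamma z * rGamma (1 - z)) has_field_derivative
          rGamma z * rGamma (1 - z) * (Digamma (1 - z) - Digamma z)) (at z)"
    by (rule derivative_eq_intros refl z
        DERIV_chain2[OF has_field_derivative_rGamma_no_nonpos_int] |
        simp add: algebra_simps)+
  hence "((\<lambda>z. sin (of_real pi * z) / of_real pi) has_field_derivative
          sin (of_real pi * z) / of_real pi * (Digamma (1 - z) - Digamma z)) (at z)"
    by (simp add: rGamma_reflection_complex)
  moreover have "((\<lambda>z. sin (of_real pi * z) / of_real pi) has_field_derivative cos (of_real pi * z)) (at z)"
    by (auto intro!: derivative_eq_intros)
  ultimately have "sin (of_real pi * z) / of_real pi * (Digamma (1 - z) - Digamma z) = cos (of_real pi * z)"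
    by (rule DERIV_unique)
  thus ?thesis
    using sin_pi_neq_0[OF assms] by (simp add: cot_def field_simps)
qed

text \<open>For non-real z this is the sum of 1 / (z + n)^2 over all integers n; at a multiple of
  \<tau> it is one row of the lattice sum for E2.\<close>

definition csc2 :: "complex \<Rightarrow> complex" where
  "csc2 z = (of_real pi / sin (of_real pi * z))\<^sup>2"

lemma csc2_minus [simp]: "csc2 (- z) = csc2 z"
  by (simp add: csc2_def power_divide)

lemma Trigamma_reflection:
  fixes z :: complex
  assumes "Im z \<noteq> 0"
  shows "Polygamma 1 (1 - z) + Polygamma 1 z = csc2 z"
proof -
  have z: "z \<notin> \<int>\<^sub>\<le>\<^sub>0" "1 - z \<notin> \<int>\<^sub>\<le>\<^sub>0"
    by (rule not_nonpos_Ints_if_Im, use assms in simp)+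
  have 1: "((\<lambda>z. Digamma (1 - z) - Digamma z) has_field_derivative
          - (Polygamma 1 (1 - z) + Polygamma 1 z)) (at z)"
    by (rule derivative_eq_intros refl z | simp)+
  have "((\<lambda>z. cot (of_real pi * z)) has_field_derivative
          - inverse ((sin (of_real pi * z))\<^sup>2) * of_real pi) (at z)"
    by (rule DERIV_chain2[where f = cot and g = "\<lambda>z. of_real pi * z" and x = z, OF DERIV_cot[OF sin_pi_neq_0[OF assms]]])
      (auto intro!: derivative_eq_intros)
  from DERIV_cmult[OF this, of "of_real pi"]
  have "((\<lambda>z. of_real pi * cot (of_real pi * z)) has_field_derivative - csc2 z) (at z)"
    by (simp add: csc2_def power_divide power2_eq_square field_simps)
  moreover have "open {z. Im z \<noteq> 0}"
    by (intro open_Collect_neq continuous_intros)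
  ultimately have "((\<lambda>z. Digamma (1 - z) - Digamma z) has_field_derivative - csc2 z) (at z)"
    using assms by (elim has_field_derivative_transform_within_open[where S = "{z. Im z \<noteq> 0}"])
      (auto simp: Digamma_reflection)
  from DERIV_unique[OF 1 this] show ?thesis
    by (simp add: algebra_simps)
qed

text \<open>The terms n and -n are paired and the term n = 0 is moved to the right. The two halves
  are the trigamma series at \<open>z + 1\<close> and at \<open>1 - z\<close>, joined by the
  reflection formula.\<close>

lemma sums_csc2:
  assumes "Im z \<noteq> 0"
  shows "(\<lambda>n. 1 / (z + of_nat (Suc n))\<^sup>2 + 1 / (z - of_nat (Suc n))\<^sup>2) sums (csc2 z - 1 / z\<^sup>2)"
proof -
  have [simp]: "z + 1 \<noteq> 0" "z \<noteq> 1" "1 - z \<noteq> 0" "z \<noteq> 0"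
    using assms by (auto simp: complex_eq_iff)
  have "(\<lambda>n. inverse ((z + 1 + of_nat n)\<^sup>2)) sums (Polygamma 1 z - 1 / z\<^sup>2)"
    using Polygamma_LIMSEQ[of "z + 1" 1] Polygamma_plus1[of z 1]
    by (simp add: numeral_2_eq_2)
  hence 1: "(\<lambda>n. 1 / (z + of_nat (Suc n))\<^sup>2) sums (Polygamma 1 z - 1 / z\<^sup>2)"
    by (simp add: field_simps)
  have "(\<lambda>n. inverse ((1 - z + of_nat n)\<^sup>2)) sums (Polygamma 1 (1 - z))"
    using Polygamma_LIMSEQ[of "1 - z" 1] by (simp add: numeral_2_eq_2)
  also have "(\<lambda>n. inverse ((1 - z + of_nat n)\<^sup>2)) = (\<lambda>n. 1 / (z - of_nat (Suc n))\<^sup>2)"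
    by (intro ext) (simp add: inverse_eq_divide power2_commute algebra_simps)
  finally have 2: "(\<lambda>n. 1 / (z - of_nat (Suc n))\<^sup>2) sums (Polygamma 1 (1 - z))" .
  from sums_add[OF 1 2] show ?thesis
    using Trigamma_reflection[OF assms] by (simp add: algebra_simps)
qed

text \<open>In the difference of the digamma series at \<open>z + 1\<close> and \<open>1 - z\<close>
  the harmonic terms and Euler's constant cancel. It evaluates the columns of the telescoping
  correction in \<open>csc2_sum_inversion\<close>.\<close>

lemma sums_cot:
  assumes "Im z \<noteq> 0"
  shows "(\<lambda>m. 1 / (of_nat (Suc m) - z) - 1 / (of_nat (Suc m) + z))
           sums (1 / z - of_real pi * cot (of_real pi * z))"
proof -
  have [simp]: "z + 1 \<noteq> 0" "z \<noteq> 1" "1 - z \<noteq> 0" "z \<noteq> 0"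
    using assms by (auto simp: complex_eq_iff)
  have 1: "(\<lambda>n. inverse (of_nat (Suc n)) - inverse (w + of_nat n)) sums (Digamma w + euler_mascheroni)"
    if "w \<noteq> 0" for w :: complex
    using summable_sums[OF summable_Digamma[OF that]] by (simp add: Digamma_def)
  have "(\<lambda>n. inverse (1 - z + of_nat n) - inverse (z + 1 + of_nat n)) sums
          (Digamma (z + 1) - Digamma (1 - z))"
    using sums_diff[OF 1[of "z + 1"] 1[of "1 - z"]] by simp
  also have "Digamma (z + 1) - Digamma (1 - z) = 1 / z - of_real pi * cot (of_real pi * z)"
    using Digamma_reflection[OF assms] Digamma_plus1[of z] by (simp add: algebra_simps)
  finally show ?thesis
    by (simp add: inverse_eq_divide algebra_simps)
qed

text \<open>With e = exp (-2 i w) the cotangent of w is i (1 + e) / (1 - e), and the norm of e is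
  exp (2 Im w). The limit i is what later becomes the anomaly pi i / \<tau>.\<close>

lemma tendsto_cot_Im_at_bot:
  assumes "filterlim (\<lambda>n. Im (f n)) at_bot F"
  shows "((\<lambda>n. cot (f n)) \<longlongrightarrow> \<i>) F"
proof -
  have "((\<lambda>n. exp (- 2 * \<i> * f n)) \<longlongrightarrow> 0) F"
  proof (rule tendsto_norm_zero_cancel)
    have "LIM n F. 2 * Im (f n) :> at_bot"
      using assms by (intro filterlim_tendsto_pos_mult_at_bot[OF tendsto_const]) auto
    thus "((\<lambda>n. norm (exp (- 2 * \<i> * f n))) \<longlongrightarrow> 0) F"
      by (auto intro: filterlim_compose[OF exp_at_bot])
  qed
  hence "((\<lambda>n. \<i> * (1 + exp (- 2 * \<i> * f n)) / (1 - exp (- 2 * \<i> * f n))) \<longlongrightarrow> \<i> * (1 + 0) / (1 - 0)) F"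
    by (intro tendsto_intros) auto
  moreover have "\<i> * (1 + exp (- 2 * \<i> * w)) / (1 - exp (- 2 * \<i> * w)) = cot w" for w
  proof -
    have *: "exp (- 2 * \<i> * w) = exp (- \<i> * w) / exp (\<i> * w)"
      by (simp add: exp_diff[symmetric] algebra_simps)
    show ?thesis
      unfolding * cot_def sin_exp_eq cos_exp_eq by (simp add: divide_simps) (simp add: algebra_simps)
  qed
  ultimately show ?thesis
    by simp
qed

text \<open>Lipschitz's formula in weight 2: writing the sine by exponentials gives csc2 z = -4 pi^2
  q / (1 - q)^2, and q / (1 - q)^2 is q times the derivative of the geometric series.\<close>

lemma sums_csc2_exp:
  assumes "Im z > 0"
  shows "(\<lambda>d. of_nat (Suc d) * exp (2 * of_real pi * \<i> * z) ^ Suc d) sums (- csc2 z / (4 * of_real pi ^ 2))"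
proof -
  define q where "q = exp (2 * of_real pi * \<i> * z)"
  have q: "norm q < 1"
    using assms by (simp add: q_def)
  have [simp]: "q \<noteq> 1"
    using q by auto
  have "sin (of_real pi * z) ^ 2 = - (1 - q)\<^sup>2 / (4 * q)"
  proof -
    define e where "e = exp (\<i> * (of_real pi * z))"
    have e: "q = e\<^sup>2" "e \<noteq> 0"
      by (simp_all add: q_def e_def exp_double[symmetric] algebra_simps)
    have s: "sin (of_real pi * z) = (e - 1 / e) / (2 * \<i>)"
      by (simp add: sin_exp_eq e_def exp_minus field_simps)
    show ?thesis
      unfolding s e(1) using e(2) by (simp add: field_simps power2_eq_square)
  qed
  hence "csc2 z = - 4 * of_real pi ^ 2 * (q / (1 - q)\<^sup>2)"
    unfolding csc2_def power_divide by (simp add: field_simps)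
  moreover have "(\<lambda>d. q * (of_nat (Suc d) * q ^ d)) sums (q * (1 / (1 - q)\<^sup>2))"
    by (intro sums_mult geometric_deriv_sums q)
  ultimately show ?thesis
    unfolding q_def[symmetric] by (simp add: mult_ac)
qed

subsection \<open>Eisenstein's double series\<close>

lemma csc2_eq_exp_series:
  assumes "Im z > 0"
  shows "(\<Sum>d. of_nat (Suc d) * exp (2 * of_real pi * \<i> * z) ^ Suc d) = - csc2 z / (4 * of_real pi ^ 2)"
  using sums_csc2_exp[OF assms] by (rule sums_unique[symmetric])

lemma suminf_swap_abs:
  fixes f :: "nat \<Rightarrow> nat \<Rightarrow> complex"
  assumes "(\<lambda>(m, n). norm (f m n)) summable_on UNIV"
  shows "(\<Sum>m. \<Sum>n. f m n) = (\<Sum>n. \<Sum>m. f m n)"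
    and "summable (\<lambda>m. \<Sum>n. f m n)"
proof -
  have inf: "infsum g UNIV = suminf g" if "g summable_on UNIV" for g :: "nat \<Rightarrow> complex"
    using has_sum_imp_sums[OF has_sum_infsum[OF that]] by (simp add: sums_iff)
  have *: "(\<lambda>(m, n). f m n) summable_on (UNIV \<times> UNIV)"
    by (rule abs_summable_summable) (use assms in \<open>simp add: case_prod_unfold\<close>)
  have **: "(\<lambda>(n, m). f m n) summable_on (UNIV \<times> UNIV)"
    using * by (subst summable_on_swap) (simp add: case_prod_unfold)
  have 1: "(\<Sum>n. f m n) = infsum (f m) UNIV" for m
    using summable_on_SigmaD1[where f = f, OF *] by (simp add: inf)
  have 2: "(\<Sum>m. f m n) = infsum (\<lambda>m. f m n) UNIV" for n
    using summable_on_SigmaD1[where f = "\<lambda>n m. f m n", OF **] by (simp add: inf)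
  have 3: "(\<lambda>m. \<Sum>n. f m n) summable_on UNIV"
    unfolding 1 by (rule summable_on_Sigma_banach[OF *])
  have 4: "(\<lambda>n. \<Sum>m. f m n) summable_on UNIV"
    unfolding 2 by (rule summable_on_Sigma_banach[OF **])
  show "summable (\<lambda>m. \<Sum>n. f m n)"
    using 3 by (rule summable_on_imp_summable)
  have "(\<Sum>m. \<Sum>n. f m n) = infsum (\<lambda>m. infsum (f m) UNIV) UNIV"
    using inf[OF 3] by (simp add: 1)
  also have "\<dots> = infsum (\<lambda>n. infsum (\<lambda>m. f m n) UNIV) UNIV"
    by (rule infsum_swap_banach) (use * in simp)
  also have "\<dots> = (\<Sum>n. \<Sum>m. f m n)"
    using inf[OF 4] by (simp add: 2)
  finally show "(\<Sum>m. \<Sum>n. f m n) = (\<Sum>n. \<Sum>m. f m n)" .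
qed

lemma summable_inverse_Suc_sq: "summable (\<lambda>n. 1 / real (Suc n) ^ 2)"
  using sums_summable[OF inverse_squares_sums] by (simp add: add_ac)

lemma abs_summable_product_Suc_sq:
  fixes f :: "nat \<Rightarrow> nat \<Rightarrow> complex"
  assumes "\<And>m n. norm (f m n) \<le> C / (real (Suc m) ^ 2 * real (Suc n) ^ 2)"
  shows "(\<lambda>(m, n). norm (f m n)) summable_on UNIV"
proof (rule summable_on_comparison_test)
  obtain S where "(\<lambda>n. 1 / real (Suc n) ^ 2) sums S"
    using summable_inverse_Suc_sq by blast
  hence S: "((\<lambda>n. 1 / real (Suc n) ^ 2) has_sum S) UNIV"
    by (intro sums_nonneg_imp_has_sum) auto
  have "(\<lambda>(m, n). 1 / real (Suc m) ^ 2 * (1 / real (Suc n) ^ 2)) summable_on UNIV \<times> UNIV"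
  proof (rule summable_on_SigmaI)
    show "((\<lambda>n. case (m, n) of (m, n) \<Rightarrow> 1 / real (Suc m) ^ 2 * (1 / real (Suc n) ^ 2)) has_sum
            1 / real (Suc m) ^ 2 * S) UNIV" for m
      using has_sum_cmult_right[OF S, of "1 / real (Suc m) ^ 2"] by simp
    show "(\<lambda>m. 1 / real (Suc m) ^ 2 * S) summable_on UNIV"
      using has_sum_imp_summable[OF has_sum_cmult_left[OF S, of S]] .
  qed auto
  from summable_on_cmult_right[OF this, of C]
  show "(\<lambda>(m, n). C / (real (Suc m) ^ 2 * real (Suc n) ^ 2)) summable_on UNIV"
    by (simp add: case_prod_unfold del: of_nat_Suc)
qed (simp_all only: case_prod_unfold assms norm_ge_zero)

text \<open>Lambert series: the pairs with (m + 1)(d + 1) = n + 1 all carry the power q^(n + 1), and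
  their weights d + 1 run through the divisors of n + 1. Absolute convergence permits this
  regrouping.\<close>

lemma lambert_sigma1:
  fixes q :: complex
  assumes q: "norm q < 1"
  shows "(\<lambda>n. of_nat (sigma1 (Suc n)) * q ^ Suc n) sums
           (\<Sum>m. \<Sum>d. of_nat (Suc d) * (q ^ Suc m) ^ Suc d)"
    and "summable (\<lambda>m. \<Sum>d. of_nat (Suc d) * (q ^ Suc m) ^ Suc d)"
proof -
  define f where "f = (\<lambda>m d. of_nat (Suc d) * (q ^ Suc m) ^ Suc d)"
  define r where "r = norm q"
  have r: "0 \<le> r" "r < 1"
    using q by (auto simp: r_def)
  have abs: "(\<lambda>(m, d). norm (f m d)) summable_on UNIV"
  proof -
    have geo: "((\<lambda>d. norm (f m d)) has_sum (r ^ Suc m / (1 - r ^ Suc m)\<^sup>2)) UNIV" for m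
    proof (rule sums_nonneg_imp_has_sum)
      have "r ^ Suc m < 1"
        using r power_less_one_iff[of r "Suc m"] by simp
      hence "norm (r ^ Suc m) < 1"
        using r by simp
      from sums_mult[OF geometric_deriv_sums[OF this], of "r ^ Suc m"]
      show "(\<lambda>d. norm (f m d)) sums (r ^ Suc m / (1 - r ^ Suc m)\<^sup>2)"
        by (simp add: f_def norm_mult norm_power r_def mult_ac del: of_nat_Suc)
    qed auto
    have "(\<lambda>m. r ^ Suc m / (1 - r ^ Suc m)\<^sup>2) summable_on UNIV"
    proof (rule summable_on_comparison_test)
      show "(\<lambda>m. r ^ Suc m / (1 - r)\<^sup>2) summable_on UNIV"
        using r by (subst summable_on_UNIV_nonneg_real_iff) (auto intro!: summable_divide summable_mult)
      fix m
      have "r ^ Suc m \<le> r"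
        using r by (simp add: mult_left_le power_le_one)
      thus "r ^ Suc m / (1 - r ^ Suc m)\<^sup>2 \<le> r ^ Suc m / (1 - r)\<^sup>2"
        using r by (intro divide_left_mono power_mono mult_pos_pos zero_less_power)
          (use power_less_one_iff[of r "Suc m"] in \<open>auto simp del: power_Suc\<close>)
    qed (use r in auto)
    hence "(\<lambda>(m, d). norm (f m d)) summable_on UNIV \<times> UNIV"
      using geo by (intro summable_on_SigmaI[where g = "\<lambda>m. r ^ Suc m / (1 - r ^ Suc m)\<^sup>2"]) auto
    thus ?thesis
      by simp
  qed
  show "summable (\<lambda>m. \<Sum>d. of_nat (Suc d) * (q ^ Suc m) ^ Suc d)"
    using suminf_swap_abs(2)[OF abs] by (simp only: f_def)
  define S where "S = infsum (\<lambda>(m, d). f m d) UNIV"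
  have S: "((\<lambda>(m, d). f m d) has_sum S) (UNIV \<times> UNIV)"
    unfolding S_def UNIV_Times_UNIV
    by (rule has_sum_infsum, rule abs_summable_summable) (use abs in \<open>simp add: case_prod_unfold\<close>)
  have "S = (\<Sum>m. \<Sum>d. f m d)"
  proof -
    have fm: "(f m has_sum infsum (f m) UNIV) UNIV" for m
      by (rule has_sum_infsum, rule summable_on_SigmaD1[where f = f, OF has_sum_imp_summable[OF S]]) simp
    have eq: "infsum (f m) UNIV = (\<Sum>d. f m d)" for m
      using has_sum_imp_sums[OF fm] by (rule sums_unique)
    have "((\<lambda>m. infsum (f m) UNIV) has_sum S) UNIV"
      by (rule has_sum_Sigma'[OF S]) (simp add: fm)
    from sums_unique[OF has_sum_imp_sums[OF this[unfolded eq]]] show ?thesis .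
  qed
  moreover have "((\<lambda>n. of_nat (sigma1 (Suc n)) * q ^ Suc n) has_sum S) UNIV"
  proof -
    have "((\<lambda>(n, d). of_nat d * q ^ Suc n) has_sum S) (SIGMA n:UNIV. {d. d dvd Suc n})"
    proof (subst has_sum_reindex_bij_betw[symmetric])
      \<comment> \<open>The outer index n stands for \<open>Suc n\<close>, hence the
        \<open>- 1\<close>; the second component is the divisor itself, hence
        \<open>Suc d\<close>.\<close>
      show "bij_betw (\<lambda>(m, d). (Suc m * Suc d - 1, Suc d)) (UNIV \<times> UNIV) (SIGMA n:UNIV. {d. d dvd Suc n})"
      proof (rule bij_betwI')
        fix x y :: "nat \<times> nat"
        obtain m d m' d' where [simp]: "x = (m, d)" "y = (m', d')"
          by (cases x, cases y)
        have "Suc m * Suc d - 1 = Suc m' * Suc d - 1 \<longleftrightarrow> Suc m * Suc d = Suc m' * Suc d"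
          by simp
        also have "\<dots> \<longleftrightarrow> m = m'"
          by (subst mult_cancel2) simp
        finally show "((case x of (m, d) \<Rightarrow> (Suc m * Suc d - 1, Suc d)) =
                       (case y of (m, d) \<Rightarrow> (Suc m * Suc d - 1, Suc d))) = (x = y)"
          by (auto simp del: mult_Suc)
      next
        fix x :: "nat \<times> nat"
        show "(case x of (m, d) \<Rightarrow> (Suc m * Suc d - 1, Suc d)) \<in> (SIGMA n:UNIV. {d. d dvd Suc n})"
        proof (cases x)
          case (Pair m d)
          have "Suc (Suc m * Suc d - 1) = Suc m * Suc d"
            by simp
          thus ?thesis
            unfolding Pair by (simp only: prod.case mem_Sigma_iff mem_Collect_eq UNIV_I dvd_triv_right simp_thms)
        qed
      next
        fix y assume "y \<in> (SIGMA n:UNIV. {d. d dvd Suc n})"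
        then obtain n d k where y: "y = (n, d)" "Suc n = d * k"
          by (auto elim!: dvdE)
        then obtain d' k' where "d = Suc d'" "k = Suc k'"
          by (cases d; cases k) auto
        hence "y = (Suc k' * Suc d' - 1, Suc d')"
          using y by (metis diff_Suc_1 mult.commute)
        thus "\<exists>x\<in>UNIV \<times> UNIV. y = (case x of (m, d) \<Rightarrow> (Suc m * Suc d - 1, Suc d))"
          by auto
      qed
      have "Suc (Suc m * Suc d - 1) = Suc m * Suc d" for m d
        by simp
      thus "((\<lambda>x. case case x of (m, d) \<Rightarrow> (Suc m * Suc d - 1, Suc d) of (n, d) \<Rightarrow> of_nat d * q ^ Suc n) has_sum S)
             (UNIV \<times> UNIV)"
        using S by (simp add: f_def case_prod_unfold del: mult_Suc mult_Suc_right of_nat_Suc power_Suc flip: power_mult)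
    qed
    thus ?thesis
    proof (rule has_sum_Sigma')
      fix n :: nat
      show "((\<lambda>d. case (n, d) of (n, d) \<Rightarrow> of_nat d * q ^ Suc n) has_sum of_nat (sigma1 (Suc n)) * q ^ Suc n)
              {d. d dvd Suc n}"
        by (rule has_sum_finiteI) (auto simp: sigma1_def sum_distrib_right)
    qed
  qed
  ultimately show "(\<lambda>n. of_nat (sigma1 (Suc n)) * q ^ Suc n) sums
           (\<Sum>m. \<Sum>d. of_nat (Suc d) * (q ^ Suc m) ^ Suc d)"
    unfolding f_def by (intro has_sum_imp_sums) (simp only:)
qed

text \<open>In this scaling E2 is half of Eisenstein's lattice sum: pi^2 / 6 = zeta(2) is the
  positive half of the row m = 0, and each m > 0 contributes a full row. The coefficient -24 times
  pi^2 / 6 cancels the factor -1 / (4 pi^2) of Lipschitz's formula.\<close>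

lemma E2_eq_csc2_sum:
  assumes "Im \<tau> > 0"
  shows "summable (\<lambda>m. csc2 (of_nat (Suc m) * \<tau>))"
    and "of_real pi ^ 2 / 6 * E2 \<tau> = of_real pi ^ 2 / 6 + (\<Sum>m. csc2 (of_nat (Suc m) * \<tau>))"
proof -
  define q where "q = exp (2 * of_real pi * \<i> * \<tau>)"
  have q: "norm q < 1"
    using assms by (simp add: q_def)
  define c :: complex where "c = - 1 / (4 * of_real pi ^ 2)"
  have c: "c \<noteq> 0"
    by (simp add: c_def)
  have *: "(\<Sum>d. of_nat (Suc d) * (q ^ Suc m) ^ Suc d) = c * csc2 (of_nat (Suc m) * \<tau>)" for m
  proof -
    have "q ^ Suc m = exp (2 * of_real pi * \<i> * (of_nat (Suc m) * \<tau>))"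
      unfolding q_def by (subst exp_of_nat_mult[symmetric]) (simp add: algebra_simps)
    thus ?thesis
      using csc2_eq_exp_series[of "of_nat (Suc m) * \<tau>"] assms
      by (simp add: c_def add_pos_nonneg)
  qed
  note L = lambert_sigma1[OF q, unfolded *]
  show summ: "summable (\<lambda>m. csc2 (of_nat (Suc m) * \<tau>))"
    using L(2) c by (simp add: summable_cmult_iff)
  have sig: "(\<Sum>n. of_nat (sigma1 (Suc n)) * q ^ Suc n) = c * (\<Sum>m. csc2 (of_nat (Suc m) * \<tau>))"
    using L(1) summ by (subst suminf_mult[symmetric]) (auto simp: sums_iff)
  show "of_real pi ^ 2 / 6 * E2 \<tau> = of_real pi ^ 2 / 6 + (\<Sum>m. csc2 (of_nat (Suc m) * \<tau>))"
    unfolding E2_def q_def[symmetric] sig by (simp add: c_def field_simps)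
qed

text \<open>The imaginary part controls m, and then the triangle inequality controls n. The slack n
  / 2 allows t to be n or n shifted by 1/2 as soon as n \<ge> 1.\<close>

lemma lattice_norm_bound:
  assumes "Im \<tau> > 0"
  obtains K where "K > 0"
    "\<And>m n t. real n / 2 \<le> \<bar>t\<bar> \<Longrightarrow> real m * real n \<le> K * norm (of_nat m * \<tau> + of_real t) ^ 2"
proof
  define a where "a = 1 / Im \<tau>"
  define b where "b = 2 * (1 + norm \<tau> / Im \<tau>)"
  have ab: "a > 0" "b > 0"
    using assms by (auto simp: a_def b_def intro!: add_pos_nonneg)
  thus "a * b > 0"
    by simp
  fix m n :: nat and t :: real
  assume t: "real n / 2 \<le> \<bar>t\<bar>"
  define X where "X = norm (of_nat m * \<tau> + of_real t)"
  have "real m * Im \<tau> \<le> X"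
    using abs_Im_le_cmod[of "of_nat m * \<tau> + of_real t"] by (simp add: X_def)
  hence 1: "real m \<le> a * X"
    using assms by (simp add: a_def field_simps)
  have "\<bar>t\<bar> \<le> X + norm (of_nat m * \<tau>)"
    unfolding X_def using norm_triangle_ineq4[of "of_nat m * \<tau> + of_real t" "of_nat m * \<tau>"] by simp
  also have "norm (of_nat m * \<tau>) \<le> a * X * norm \<tau>"
    unfolding norm_mult norm_of_nat by (intro mult_right_mono 1) auto
  finally have "real n \<le> 2 * (X + a * X * norm \<tau>)"
    using t by simp
  also have "\<dots> = b * X"
    by (simp add: a_def b_def field_simps)
  finally have 2: "real n \<le> b * X" .
  have "real m * real n \<le> (a * X) * (b * X)"
    using 1 2 ab by (intro mult_mono) (auto simp: X_def)
  thus "real m * real n \<le> a * b * X ^ 2"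
    by (simp add: power2_eq_square mult_ac)
qed

text \<open>The difference is exactly -1 / (4 x^2 (x^2 - 1/4)), so it decays to fourth order. With a
  of size m n this is the summable majorant 1 / (m^2 n^2).\<close>

lemma norm_inverse_sq_minus_telescope_le:
  fixes x :: complex
  assumes "norm x ^ 2 \<ge> a" "norm (x - 1/2) ^ 2 \<ge> a" "norm (x + 1/2) ^ 2 \<ge> a" "a > 0"
  shows "norm (1 / x\<^sup>2 - (1 / (x - 1/2) - 1 / (x + 1/2))) \<le> 1 / (4 * a\<^sup>2)"
proof -
  have "norm x \<noteq> 0" "norm (x - 1/2) \<noteq> 0" "norm (x + 1/2) \<noteq> 0"
    using assms by (metis not_le zero_power2)+
  hence "x \<noteq> 0" "x - 1/2 \<noteq> 0" "x + 1/2 \<noteq> 0"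
    unfolding norm_eq_zero .
  hence [simp]: "x \<noteq> 0" "x \<noteq> 1/2" "x - 1/2 \<noteq> 0" "x + 1/2 \<noteq> 0" "x * 2 \<noteq> 1" "2 * x \<noteq> 1" "1 + x * 2 \<noteq> 0" "1 + 2 * x \<noteq> 0"
    by (auto simp: field_simps)
  have "1 / x\<^sup>2 - (1 / (x - 1/2) - 1 / (x + 1/2)) = - 1 / (4 * (x\<^sup>2 * ((x - 1/2) * (x + 1/2))))"
    by (simp add: divide_simps) (auto simp: algebra_simps power2_eq_square)
  also have "norm \<dots> = 1 / (4 * (norm x ^ 2 * (norm (x - 1/2) * norm (x + 1/2))))"
    by (simp add: norm_divide norm_mult norm_power)
  also have "\<dots> \<le> 1 / (4 * (a * a))"
  proof (intro divide_left_mono mult_left_mono mult_mono)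
    show "a \<le> norm (x - 1/2) * norm (x + 1/2)"
    proof (rule power2_le_imp_le)
      have "a * a \<le> norm (x - 1/2) ^ 2 * norm (x + 1/2) ^ 2"
        using assms by (intro mult_mono) auto
      thus "a ^ 2 \<le> (norm (x - 1/2) * norm (x + 1/2)) ^ 2"
        by (simp add: power_mult_distrib power2_eq_square[of a])
    qed simp
    show "0 < 4 * (norm x ^ 2 * (norm (x - 1/2) * norm (x + 1/2))) * (4 * (a * a))"
      by (intro mult_pos_pos assms zero_less_power) auto
  qed (use assms in auto)
  finally show ?thesis
    by (simp add: power2_eq_square)
qed

text \<open>
  Interchanging the two conditionally convergent summations over the lattice produces the
  anomaly \<open>\<pi> \<i> / \<tau>\<close>. It is isolated by subtracting from \<open>1 / x\<^sup>2\<close> the telescoping term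
  \<open>1 / (x - 1/2) - 1 / (x + 1/2)\<close>, which makes the double series absolutely convergent.
\<close>

lemma csc2_sum_inversion:
  assumes \<tau>: "Im \<tau> > 0"
  shows "(\<Sum>m. csc2 (of_nat (Suc m) * \<tau>)) - of_real pi ^ 2 / (6 * \<tau>\<^sup>2) =
         (\<Sum>n. csc2 (of_nat (Suc n) * (- 1 / \<tau>))) / \<tau>\<^sup>2 - of_real pi ^ 2 / 6 + of_real pi * \<i> / \<tau>"
proof -
  have [simp]: "\<tau> \<noteq> 0"
    using \<tau> by auto
  have \<tau>': "Im (- 1 / \<tau>) > 0"
    using \<tau> by (simp add: Im_divide sum_power2_gt_zero_iff complex_neq_0)
  have Im_scale: "Im (of_real x / \<tau>) = x * Im (1 / \<tau>)" for x
    by (simp add: Im_divide)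
  define u where "u = (\<lambda>m n. 1 / (of_nat (Suc m) * \<tau> + of_nat (Suc n))\<^sup>2
                           + 1 / (of_nat (Suc m) * \<tau> - of_nat (Suc n))\<^sup>2)"
  \<comment> \<open>\<open>g m n - g m (Suc n)\<close> is the telescoping term at the two lattice
    points paired in \<open>u m n\<close>; the half-integer \<open>n + 1/2\<close> is
    \<open>Suc n - 1/2\<close>.\<close>
  define g where "g = (\<lambda>m n. 1 / (of_nat (Suc m) * \<tau> + (of_nat n + 1/2))
                           - 1 / (of_nat (Suc m) * \<tau> - (of_nat n + 1/2)))"
  define w where "w = (\<lambda>n. (of_nat n + 1/2) / \<tau>)"
  \<comment> \<open>The column sum of \<open>g\<close>, obtained by taking the factor \<tau> out of
    the denominators and applying \<open>sums_cot\<close> at \<open>w n\<close>.\<close>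
  define G where "G = (\<lambda>n. - (1 / w n - of_real pi * cot (of_real pi * w n)) / \<tau>)"
  define F where "F = (\<lambda>m n. u m n - (g m n - g m (Suc n)))"

  have half_infinity: "filterlim (\<lambda>n. of_nat n + 1/2 :: complex) at_infinity sequentially"
    by (rule tendsto_add_filterlim_at_infinity'[OF tendsto_of_nat tendsto_const])

  obtain K where K: "K > 0"
    "\<And>m n t. real n / 2 \<le> \<bar>t\<bar> \<Longrightarrow> real m * real n \<le> K * norm (of_nat m * \<tau> + of_real t) ^ 2"
    using lattice_norm_bound[OF \<tau>] by blast
  have "norm (F m n) \<le> K\<^sup>2 / 2 / (real (Suc m) ^ 2 * real (Suc n) ^ 2)" for m n
  proof -
    define a where "a = real (Suc m) * real (Suc n) / K"
    have a: "a > 0"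
      using K by (simp add: a_def)
    have *: "a \<le> norm (of_nat (Suc m) * \<tau> + of_real t) ^ 2" if "real (Suc n) / 2 \<le> \<bar>t\<bar>" for t
      using K(2)[OF that, of "Suc m"] K(1) by (simp add: a_def field_simps del: of_nat_Suc)
    define D where "D = (\<lambda>x::complex. 1 / x\<^sup>2 - (1 / (x - 1/2) - 1 / (x + 1/2)))"
    have D: "norm (D (of_nat (Suc m) * \<tau> + of_real t)) \<le> 1 / (4 * a\<^sup>2)"
      if "\<bar>t\<bar> = real (Suc n)" for t
      unfolding D_def
    proof (rule norm_inverse_sq_minus_telescope_le)
      show "a \<le> norm (of_nat (Suc m) * \<tau> + of_real t) ^ 2"
        by (rule *) (use that in \<open>auto simp: abs_if split: if_splits\<close>)
      have "a \<le> norm (of_nat (Suc m) * \<tau> + of_real (t - 1/2)) ^ 2"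
        by (rule *) (use that in \<open>auto simp: abs_if split: if_splits\<close>)
      thus "a \<le> norm (of_nat (Suc m) * \<tau> + of_real t - 1/2) ^ 2"
        by (simp add: algebra_simps)
      have "a \<le> norm (of_nat (Suc m) * \<tau> + of_real (t + 1/2)) ^ 2"
        by (rule *) (use that in \<open>auto simp: abs_if split: if_splits\<close>)
      thus "a \<le> norm (of_nat (Suc m) * \<tau> + of_real t + 1/2) ^ 2"
        by (simp add: algebra_simps)
    qed (fact a)
    have "F m n = D (of_nat (Suc m) * \<tau> + of_real (real (Suc n))) +
                  D (of_nat (Suc m) * \<tau> + of_real (- real (Suc n)))"
      by (simp add: F_def D_def u_def g_def algebra_simps)
    also have "norm \<dots> \<le> 1 / (4 * a\<^sup>2) + 1 / (4 * a\<^sup>2)"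
      by (intro norm_triangle_mono D) auto
    also have "\<dots> = K\<^sup>2 / 2 / (real (Suc m) ^ 2 * real (Suc n) ^ 2)"
      by (simp add: a_def power_divide power_mult_distrib)
    finally show ?thesis .
  qed
  note swap = suminf_swap_abs[OF abs_summable_product_Suc_sq[OF this]]

  have u1: "u m sums (csc2 (of_nat (Suc m) * \<tau>) - 1 / (of_nat (Suc m) * \<tau>)\<^sup>2)" for m
    unfolding u_def by (rule sums_csc2) (use \<tau> in simp)
  \<comment> \<open>Dividing by \<tau> turns a column of the lattice of \<tau> into a row of the
    lattice of -1 / \<tau>; this costs the factor 1 / \<tau>^2.\<close>
  have u2: "(\<lambda>m. u m n) sums (csc2 (of_nat (Suc n) * (- 1 / \<tau>)) / \<tau>\<^sup>2 - 1 / of_nat (Suc n) ^ 2)" for n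
  proof -
    define z where "z = of_nat (Suc n) / \<tau>"
    have z: "Im z \<noteq> 0" "of_nat (Suc n) = z * \<tau>"
      using \<tau>' Im_scale[of "real (Suc n)"] by (simp_all add: z_def del: of_nat_Suc)
    have "of_nat (Suc n) * (- 1 / \<tau>) = - z"
      by (simp add: z_def)
    moreover have "1 / \<tau>\<^sup>2 * (1 / (z + k)\<^sup>2 + 1 / (z - k)\<^sup>2) = 1 / (k * \<tau> + z * \<tau>)\<^sup>2 + 1 / (k * \<tau> - z * \<tau>)\<^sup>2" for k
    proof -
      have "(k * \<tau> + z * \<tau>)\<^sup>2 = (z + k)\<^sup>2 * \<tau>\<^sup>2" "(k * \<tau> - z * \<tau>)\<^sup>2 = (z - k)\<^sup>2 * \<tau>\<^sup>2"
        by (simp_all add: power2_eq_square algebra_simps)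
      thus ?thesis
        by (simp add: field_simps)
    qed
    ultimately show ?thesis
      using sums_mult[OF sums_csc2[OF z(1)], of "1 / \<tau>\<^sup>2"]
      unfolding u_def z(2) by (simp add: power_mult_distrib diff_divide_distrib)
  qed
  have g1: "(\<lambda>n. g m n - g m (Suc n)) sums (g m 0)" for m
  proof -
    have "(\<lambda>n. 1 / (c + s * (of_nat n + 1/2))) \<longlonglongrightarrow> 0" if "s \<noteq> 0" for s c :: complex
      using that
      by (intro tendsto_divide_0[OF tendsto_const] tendsto_add_filterlim_at_infinity[OF tendsto_const]
          tendsto_mult_filterlim_at_infinity[OF tendsto_const] half_infinity)
    from tendsto_diff[OF this[of 1 "of_nat (Suc m) * \<tau>"] this[of "- 1" "of_nat (Suc m) * \<tau>"]]
    have "g m \<longlonglongrightarrow> 0"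
      by (simp add: g_def algebra_simps)
    thus ?thesis
      using telescope_sums'[of "g m" 0] by simp
  qed
  have g2: "(\<lambda>m. g m n) sums G n" for n
  proof -
    have z: "Im (w n) \<noteq> 0" "of_nat n + 1/2 = w n * \<tau>"
      using \<tau>' Im_scale[of "real n + 1/2"] by (auto simp: w_def)
    have "- (1 / (k - w n) - 1 / (k + w n)) / \<tau> = 1 / (k * \<tau> + w n * \<tau>) - 1 / (k * \<tau> - w n * \<tau>)" for k
      by (simp add: diff_divide_distrib flip: distrib_right left_diff_distrib)
    thus ?thesis
      using sums_divide[OF sums_minus[OF sums_cot[OF z(1)]], of \<tau>]
      unfolding g_def z(2) G_def by simp
  qed
  have zeta: "(\<lambda>n. 1 / of_nat (Suc n) ^ 2) sums (of_real pi ^ 2 / 6 :: complex)"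
    using sums_of_real[OF inverse_squares_sums, where ?'a = complex] by (simp add: add_ac)

  have 1: "(\<lambda>m. \<Sum>n. F m n) sums
          ((\<Sum>m. csc2 (of_nat (Suc m) * \<tau>)) - of_real pi ^ 2 / 6 / \<tau>\<^sup>2 - G 0)"
  proof -
    have "(\<Sum>n. F m n) = csc2 (of_nat (Suc m) * \<tau>) - 1 / of_nat (Suc m) ^ 2 / \<tau>\<^sup>2 - g m 0" for m
      using sums_diff[OF u1 g1, of m] unfolding F_def
      by (simp add: sums_iff power_mult_distrib)
    moreover have "(\<lambda>m. csc2 (of_nat (Suc m) * \<tau>) - 1 / of_nat (Suc m) ^ 2 / \<tau>\<^sup>2 - g m 0) sums
          ((\<Sum>m. csc2 (of_nat (Suc m) * \<tau>)) - of_real pi ^ 2 / 6 / \<tau>\<^sup>2 - G 0)"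
      by (intro sums_diff sums_divide zeta g2 summable_sums E2_eq_csc2_sum \<tau>)
    ultimately show ?thesis
      by simp
  qed
  \<comment> \<open>Summed by rows the correction contributes G 0; summed by columns it contributes
    G 0 minus the limit of G. The limit pi i / \<tau> is all that survives of it: Im (1 / \<tau>) <
    0 drives \<open>w n\<close> down the lower half-plane.\<close>
  have 2: "(\<lambda>n. \<Sum>m. F m n) sums
          ((\<Sum>n. csc2 (of_nat (Suc n) * (- 1 / \<tau>))) / \<tau>\<^sup>2 - of_real pi ^ 2 / 6 - (G 0 - of_real pi * \<i> / \<tau>))"
  proof -
    have "filterlim w at_infinity sequentially"
      unfolding w_def divide_inverse[of _ \<tau>] mult.commute[of _ "inverse \<tau>"]
      by (rule tendsto_mult_filterlim_at_infinity[OF tendsto_const]) (simp_all add: half_infinity)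
    hence inv: "(\<lambda>n. 1 / w n) \<longlonglongrightarrow> 0"
      by (rule tendsto_divide_0[OF tendsto_const])
    define c where "c = - (pi * Im (1 / \<tau>))"
    have "c > 0"
      using \<tau>' by (simp add: c_def mult_pos_neg)
    hence "filterlim (\<lambda>n. - c * (1/2 + real n)) at_bot sequentially"
      by (intro filterlim_tendsto_neg_mult_at_bot[OF tendsto_const]
            filterlim_tendsto_add_at_top[OF tendsto_const] filterlim_real_sequentially) auto
    moreover have "(\<lambda>n. Im (of_real pi * w n)) = (\<lambda>n. - c * (1/2 + real n))"
    proof
      fix n
      have "Im (of_real pi * w n) = pi * Im (w n)"
        by simp
      also have "Im (w n) = (1/2 + real n) * Im (1 / \<tau>)"
        using Im_scale[of "1/2 + real n"] by (simp add: w_def add_ac)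
      finally show "Im (of_real pi * w n) = - c * (1/2 + real n)"
        by (simp add: c_def)
    qed
    ultimately have "filterlim (\<lambda>n. Im (of_real pi * w n)) at_bot sequentially"
      by simp
    from tendsto_cot_Im_at_bot[OF this] inv
    have "G \<longlonglongrightarrow> - (0 - of_real pi * \<i>) / \<tau>"
      unfolding G_def by (intro tendsto_intros) auto
    hence "G \<longlonglongrightarrow> of_real pi * \<i> / \<tau>"
      by simp
    from telescope_sums'[OF this]
    have tele: "(\<lambda>n. G n - G (Suc n)) sums (G 0 - of_real pi * \<i> / \<tau>)" .
    have "(\<Sum>m. F m n) = csc2 (of_nat (Suc n) * (- 1 / \<tau>)) / \<tau>\<^sup>2 - 1 / of_nat (Suc n) ^ 2 - (G n - G (Suc n))" for n
      using sums_diff[OF u2 sums_diff[OF g2 g2], of n n "Suc n"] unfolding F_def by (simp add: sums_iff)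
    thus ?thesis
      by (simp only:) (intro sums_diff[OF sums_diff[OF sums_divide[OF summable_sums] zeta] tele]
          E2_eq_csc2_sum(1) \<tau>')
  qed
  show ?thesis
    using 1 2 swap(1) by (simp add: sums_iff)
qed

section \<open>The transformation law of E2 under the full modular group\<close>

lemma E2_inversion:
  assumes "Im \<tau> > 0"
  shows "E2 (- 1 / \<tau>) = \<tau>\<^sup>2 * E2 \<tau> + 6 * \<tau> / (of_real pi * \<i>)"
proof -
  have "\<tau> \<noteq> 0" and \<tau>': "Im (- 1 / \<tau>) > 0"
    using assms by (auto simp: Im_divide sum_power2_gt_zero_iff complex_neq_0)
  \<comment> \<open>The inversion exchanges the two axes of the lattice, which the double series
    leaves out; their sums pi^2 / 6 and pi^2 / (6 \<tau>^2) complete the two sides to values of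
    E2.\<close>
  have "of_real pi ^ 2 / 6 * E2 (- 1 / \<tau>) = of_real pi ^ 2 / 6 * (\<tau>\<^sup>2 * E2 \<tau> + 6 * \<tau> / (of_real pi * \<i>))"
    using csc2_sum_inversion[OF assms] \<open>\<tau> \<noteq> 0\<close>
    unfolding distrib_left E2_eq_csc2_sum(2)[OF \<tau>'] mult.left_commute[of _ "\<tau>\<^sup>2"] E2_eq_csc2_sum(2)[OF assms]
    by (simp add: field_simps power2_eq_square)
  thus ?thesis
    by simp
qed

lemma E2_plus_int: "E2 (\<tau> + of_int k) = E2 \<tau>"
proof -
  have "2 * of_real pi * \<i> * (\<tau> + of_int k) = 2 * of_real pi * \<i> * \<tau> + \<i> * (of_int k * (of_real pi * 2))"
    by (simp add: algebra_simps)
  thus ?thesis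
    by (simp add: E2_def)
qed

lemma aut_factor_nonzero:
  assumes "(a, b, c, d) \<in> SL2Z" "Im \<tau> > 0"
  shows "aut_factor c d \<tau> \<noteq> 0"
proof
  assume *: "aut_factor c d \<tau> = 0"
  hence "Im (aut_factor c d \<tau>) = 0"
    by simp
  hence "c = 0"
    using assms by (simp add: aut_factor_def)
  thus False
    using * assms by (simp add: aut_factor_def SL2Z_def)
qed

lemma Im_moebius:
  assumes "(a, b, c, d) \<in> SL2Z"
  shows "Im (moebius a b c d \<tau>) = Im \<tau> / norm (aut_factor c d \<tau>) ^ 2"
proof -
  define x y where "x = Re \<tau>" "y = Im \<tau>"
  have "of_int (a * d - b * c) = (1 :: real)"
    using assms by (simp add: SL2Z_def)
  hence "(a * y) * (c * x + d) - (a * x + b) * (c * y) = y"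
    by (simp add: algebra_simps flip: distrib_left right_diff_distrib)
  thus ?thesis
    unfolding moebius_def aut_factor_def Im_divide cmod_power2 by (simp add: x_y_def)
qed

text \<open>
  Euclid's algorithm on the bottom row: the translation by \<open>- k\<close> reduces \<open>d\<close> modulo \<open>c\<close>, and the
  inversion then exchanges the two entries.
\<close>

lemma E2_moebius:
  assumes "(a, b, c, d) \<in> SL2Z" "Im \<tau> > 0"
  shows "E2 (moebius a b c d \<tau>) =
           aut_factor c d \<tau> ^ 2 * E2 \<tau> + 6 * of_int c * aut_factor c d \<tau> / (of_real pi * \<i>)"
  using assms
proof (induction "nat \<bar>c\<bar>" arbitrary: a b c d \<tau> rule: less_induct)
  case less
  show ?case
  proof (cases "c = 0")
    case True
    hence "a * d = 1"
      using less.prems by (simp add: SL2Z_def)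
    hence ad: "a = 1 \<and> d = 1 \<or> a = - 1 \<and> d = - 1"
      by (rule zmult_eq_1_iff[THEN iffD1])
    hence "moebius a b c d \<tau> = \<tau> + of_int (b * d)"
      using True by (auto simp: moebius_def)
    thus ?thesis
      using ad True by (auto simp: E2_plus_int aut_factor_def simp del: of_int_mult)
  next
    case False
    define k where "k = - (d div c)"
    define b' d' where "b' = b + k * a" and "d' = d + k * c"
    define \<sigma> where "\<sigma> = \<tau> - of_int k"
    have "d' = d mod c"
      using minus_div_mult_eq_mod[of d c] by (simp add: d'_def k_def)
    hence "nat \<bar>d'\<bar> < nat \<bar>c\<bar>"
      using False abs_mod_less[of c d] by simp
    \<comment> \<open>The given matrix times the translation by k times the inversion; it acts on -1
      / \<sigma>, and its lower left entry is the remainder d'.\<close>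
    moreover have "(b', - a, d', - c) \<in> SL2Z"
      using less.prems by (simp add: SL2Z_def b'_def d'_def algebra_simps)
    moreover have \<sigma>: "Im \<sigma> > 0" "\<sigma> \<noteq> 0"
      using less.prems by (auto simp: \<sigma>_def)
    hence "Im (- 1 / \<sigma>) > 0"
      by (simp add: Im_divide sum_power2_gt_zero_iff complex_neq_0)
    ultimately have IH: "E2 (moebius b' (- a) d' (- c) (- 1 / \<sigma>)) =
        aut_factor d' (- c) (- 1 / \<sigma>) ^ 2 * E2 (- 1 / \<sigma>) +
        6 * of_int d' * aut_factor d' (- c) (- 1 / \<sigma>) / (of_real pi * \<i>)"
      by (rule less.hyps)
    define J where "J = aut_factor c d \<tau>"
    have J: "J = of_int c * \<sigma> + of_int d'"
      by (simp add: J_def aut_factor_def \<sigma>_def d'_def algebra_simps)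
    have "J \<noteq> 0"
      unfolding J_def using less.prems by (rule aut_factor_nonzero)
    have J': "aut_factor d' (- c) (- 1 / \<sigma>) = - J / \<sigma>"
      using \<sigma> by (simp add: aut_factor_def J field_simps)
    have "moebius b' (- a) d' (- c) (- 1 / \<sigma>) = - (of_int a * \<sigma> + of_int b') / \<sigma> / (- J / \<sigma>)"
      using \<sigma> unfolding moebius_def J'[symmetric] aut_factor_def by (simp add: field_simps)
    also have "\<dots> = moebius a b c d \<tau>"
    proof -
      have "of_int a * \<sigma> + of_int b' = of_int a * \<tau> + of_int b"
        by (simp add: b'_def \<sigma>_def algebra_simps)
      moreover have "- N / \<sigma> / (- J / \<sigma>) = N / J" for N
        using \<sigma> by simp
      ultimately show ?thesis
        by (simp only: moebius_def J_def[unfolded aut_factor_def])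
    qed
    finally have "E2 (moebius a b c d \<tau>) =
      (- J / \<sigma>) ^ 2 * (\<sigma>\<^sup>2 * E2 \<sigma> + 6 * \<sigma> / (of_real pi * \<i>)) + 6 * of_int d' * (- J / \<sigma>) / (of_real pi * \<i>)"
      using IH unfolding J' E2_inversion[OF \<sigma>(1)] by simp
    \<comment> \<open>The anomalies of the inversion and of the induction hypothesis combine to a
      multiple of J (J - d') / \<sigma>, and J - d' = c \<sigma>.\<close>
    also have "\<dots> = J ^ 2 * E2 \<sigma> + 6 / (of_real pi * \<i>) * J * ((J - of_int d') / \<sigma>)"
      using \<sigma> by (simp add: field_simps power2_eq_square)
    also have "(J - of_int d') / \<sigma> = of_int c"
      using \<sigma> by (simp add: J)
    also have "E2 \<sigma> = E2 \<tau>"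
      using E2_plus_int[of \<sigma> k] by (simp add: \<sigma>_def)
    finally show ?thesis
      by (simp add: J_def)
  qed
qed

subsection \<open>Power series with antiholomorphic coefficients\<close>

text \<open>
  The value \<open>F 0\<close> is left free: the definition is applied to \<open>f z / z powi N\<close>, which has no
  meaningful value at \<open>0\<close>. The geometric bound is stated in the independent variable \<open>w\<close>; it is
  what allows products and shows that \<open>F\<close> determines the values \<open>a i 0\<close>.
\<close>

definition conj_series :: "real \<Rightarrow> (nat \<Rightarrow> complex \<Rightarrow> complex) \<Rightarrow> (complex \<Rightarrow> complex) \<Rightarrow> bool" where
  "conj_series s a F \<longleftrightarrow> s > 0 \<and> (\<forall>i. a i holomorphic_on ball 0 s) \<and>
     (\<exists>C. \<forall>i. \<forall>w\<in>ball 0 s. norm (a i w) \<le> C / s ^ i) \<and>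
     (\<forall>z. z \<noteq> 0 \<and> norm z < s \<longrightarrow> (\<lambda>i. a i (cnj z) * z ^ i) sums F z)"

lemma conj_seriesI:
  assumes "s > 0" "\<And>i. a i holomorphic_on ball 0 s"
    and "\<And>i w. w \<in> ball 0 s \<Longrightarrow> norm (a i w) \<le> C / s ^ i"
    and "\<And>z. z \<noteq> 0 \<Longrightarrow> norm z < s \<Longrightarrow> (\<lambda>i. a i (cnj z) * z ^ i) sums F z"
  shows "conj_series s a F"
  using assms unfolding conj_series_def by blast

lemma conj_seriesD:
  assumes "conj_series s a F"
  shows "s > 0" "a i holomorphic_on ball 0 s"
    and "z \<noteq> 0 \<Longrightarrow> norm z < s \<Longrightarrow> (\<lambda>i. a i (cnj z) * z ^ i) sums F z"
  using assms by (auto simp: conj_series_def)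

lemma conj_series_bound:
  assumes "conj_series s a F"
  obtains C where "C \<ge> 0" "\<And>i w. w \<in> ball 0 s \<Longrightarrow> norm (a i w) \<le> C / s ^ i"
proof -
  from assms obtain C where C: "\<And>i w. w \<in> ball 0 s \<Longrightarrow> norm (a i w) \<le> C / s ^ i" and "s > 0"
    unfolding conj_series_def by blast
  have "0 \<le> norm (a 0 0)"
    by simp
  also have "\<dots> \<le> C"
    using C[of 0 0] \<open>s > 0\<close> by simp
  finally show ?thesis
    using that C by blast
qed

lemma conj_series_cong:
  assumes "conj_series s a F" "\<And>z. z \<noteq> 0 \<Longrightarrow> F z = G z"
  shows "conj_series s a G"
  using assms by (simp add: conj_series_def)

lemma conj_series_mono:
  assumes "conj_series s a F" "0 < t" "t \<le> s"
  shows "conj_series t a F"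
proof -
  obtain C where C: "C \<ge> 0" "\<And>i w. w \<in> ball 0 s \<Longrightarrow> norm (a i w) \<le> C / s ^ i"
    by (rule conj_series_bound[OF assms(1)]) (rule that)
  have "norm (a i w) \<le> C / t ^ i" if "w \<in> ball 0 t" for i w
  proof -
    have "norm (a i w) \<le> C / s ^ i"
      using that assms by (intro C) auto
    also have "\<dots> \<le> C / t ^ i"
      using assms C by (intro divide_left_mono power_mono mult_pos_pos) auto
    finally show ?thesis .
  qed
  moreover have "a i holomorphic_on ball 0 t" for i
    using conj_seriesD(2)[OF assms(1)] by (rule holomorphic_on_subset) (use assms in auto)
  moreover have "(\<lambda>i. a i (cnj z) * z ^ i) sums F z" if "z \<noteq> 0" "norm z < t" for z
    using that assms by (intro conj_seriesD(3)[OF assms(1)]) auto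
  ultimately show ?thesis
    using assms(2) by (intro conj_seriesI[where C = C])
qed

lemma conj_series_cmult:
  assumes "conj_series s a F"
  shows "conj_series s (\<lambda>i w. c * a i w) (\<lambda>z. c * F z)"
proof -
  obtain C where C: "C \<ge> 0" "\<And>i w. w \<in> ball 0 s \<Longrightarrow> norm (a i w) \<le> C / s ^ i"
    by (rule conj_series_bound[OF assms]) (rule that)
  have "norm (c * a i w) \<le> norm c * C / s ^ i" if "w \<in> ball 0 s" for i w
    using mult_left_mono[OF C(2)[OF that, of i], of "norm c"] by (simp add: norm_mult)
  moreover have "(\<lambda>i. c * a i (cnj z) * z ^ i) sums (c * F z)" if "z \<noteq> 0" "norm z < s" for z
    using sums_mult[OF conj_seriesD(3)[OF assms that], of c] by (simp add: mult.assoc)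
  ultimately show ?thesis
    using conj_seriesD(1,2)[OF assms]
    by (intro conj_seriesI[where C = "norm c * C"] holomorphic_intros) auto
qed

lemma conj_series_diff:
  assumes "conj_series s a F" "conj_series t b G"
  shows "conj_series (min s t) (\<lambda>i w. a i w - b i w) (\<lambda>z. F z - G z)"
proof -
  define u where "u = min s t"
  have a: "conj_series u a F" and b: "conj_series u b G"
    using assms conj_seriesD(1)[OF assms(1)] conj_seriesD(1)[OF assms(2)]
    by (auto intro: conj_series_mono simp: u_def)
  obtain C where C: "C \<ge> 0" "\<And>i w. w \<in> ball 0 u \<Longrightarrow> norm (a i w) \<le> C / u ^ i"
    by (rule conj_series_bound[OF a]) (rule that)
  obtain D where D: "D \<ge> 0" "\<And>i w. w \<in> ball 0 u \<Longrightarrow> norm (b i w) \<le> D / u ^ i"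
    by (rule conj_series_bound[OF b]) (rule that)
  have "norm (a i w - b i w) \<le> (C + D) / u ^ i" if "w \<in> ball 0 u" for i w
    using norm_triangle_ineq4[of "a i w" "b i w"] C(2)[OF that, of i] D(2)[OF that, of i]
    by (simp add: add_divide_distrib)
  moreover have "(\<lambda>i. (a i (cnj z) - b i (cnj z)) * z ^ i) sums (F z - G z)" if "z \<noteq> 0" "norm z < u" for z
    using sums_diff[OF conj_seriesD(3)[OF a that] conj_seriesD(3)[OF b that]]
    by (simp add: left_diff_distrib)
  ultimately show ?thesis
    using conj_seriesD(1,2)[OF a] conj_seriesD(2)[OF b] unfolding u_def[symmetric]
    by (intro conj_seriesI[where C = "C + D"] holomorphic_intros) auto
qed

text \<open>The conjugate variable is divided by \<open>cnj J\<close>, so the new coefficients are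
  not multiples of the old ones. At w = 0 they are: there only the factor 1 / J^i remains.\<close>

lemma conj_series_scale:
  assumes "conj_series s a F" "J \<noteq> 0"
  shows "conj_series (s * norm J) (\<lambda>i w. a i (w / cnj J) / J ^ i) (\<lambda>z. F (z / J))"
proof -
  obtain C where C: "C \<ge> 0" "\<And>i w. w \<in> ball 0 s \<Longrightarrow> norm (a i w) \<le> C / s ^ i"
    by (rule conj_series_bound[OF assms(1)]) (rule that)
  have ball: "w / cnj J \<in> ball 0 s" if "w \<in> ball 0 (s * norm J)" for w
    using that assms by (simp add: norm_divide pos_divide_less_eq)
  have "norm (a i (w / cnj J) / J ^ i) \<le> C / (s * norm J) ^ i" if "w \<in> ball 0 (s * norm J)" for i w
    using divide_right_mono[OF C(2)[OF ball[OF that], of i], of "norm J ^ i"]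
    by (simp add: norm_divide norm_power power_mult_distrib)
  moreover have "(\<lambda>w. a i (w / cnj J) / J ^ i) holomorphic_on ball 0 (s * norm J)" for i
  proof -
    have "(\<lambda>w. w / cnj J) holomorphic_on ball 0 (s * norm J)"
      by (rule holomorphic_on_divide[OF holomorphic_on_ident holomorphic_on_const]) (use assms in simp)
    moreover have "(\<lambda>w. w / cnj J) ` ball 0 (s * norm J) \<subseteq> ball 0 s"
      using ball by blast
    ultimately have "(a i \<circ> (\<lambda>w. w / cnj J)) holomorphic_on ball 0 (s * norm J)"
      by (rule holomorphic_on_compose_gen[OF _ conj_seriesD(2)[OF assms(1)]])
    thus ?thesis
      unfolding o_def by (rule holomorphic_on_divide[OF _ holomorphic_on_const]) (use assms in simp)
  qed
  moreover have "(\<lambda>i. a i (cnj z / cnj J) / J ^ i * z ^ i) sums F (z / J)" if "z \<noteq> 0" "norm z < s * norm J" for z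
  proof -
    have "norm (z / J) < s"
      using that assms by (simp add: norm_divide pos_divide_less_eq)
    thus ?thesis
      using conj_seriesD(3)[OF assms(1), of "z / J"] that assms(2) by (simp add: power_divide)
  qed
  ultimately show ?thesis
    using assms(2) conj_seriesD(1)[OF assms(1)] by (intro conj_seriesI[where C = C]) auto
qed

text \<open>
  On the circle \<open>norm w = t\<close> one has \<open>cnj w = t\<^sup>2 / w\<close>, so there \<open>w ^ l\<close> times the partial sum of
  order \<open>l\<close> is the polynomial \<open>P\<close> below, with \<open>P 0 = a l 0 * t ^ (2 * l)\<close>, and it is small
  because the whole series vanishes.
\<close>

lemma conj_series_zero_imp_coeff_zero:
  assumes "conj_series s a (\<lambda>_. 0)"
  shows "a l 0 = 0"
proof -
  have s: "s > 0"
    using conj_seriesD(1)[OF assms] .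
  obtain C where C: "C \<ge> 0" "\<And>i w. w \<in> ball 0 s \<Longrightarrow> norm (a i w) \<le> C / s ^ i"
    by (rule conj_series_bound[OF assms]) (rule that)
  \<comment> \<open>The restriction t < s / 2 gives 1 / (1 - t / s) \<le> 2, the source of the
    factor 2.\<close>
  have le: "norm (a l 0) \<le> 2 * C / s ^ Suc l * t" if t: "0 < t" "t < s / 2" for t
  proof -
    define P where "P = (\<lambda>w. \<Sum>i\<le>l. a i w * of_real (t ^ (2 * i)) * w ^ (l - i))"
    define x where "x = t / s"
    have x: "0 < x" "x < 1 / 2"
      using t s by (auto simp: x_def field_simps)
    have hol: "P holomorphic_on ball 0 s"
      unfolding P_def by (intro holomorphic_intros conj_seriesD(2)[OF assms])
    have bound: "norm (P w) \<le> t ^ l * (2 * C * x ^ Suc l)" if w: "norm w = t" for w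
    proof -
      \<comment> \<open>At this z the coefficients are evaluated at w itself, hence depend
        holomorphically on w.\<close>
      define z where "z = cnj w"
      have z: "z \<noteq> 0" "norm z = t" "w \<noteq> 0" and zw: "z * w = of_real (t ^ 2)"
        using w t complex_norm_square[of w] by (auto simp: z_def mult.commute)
      have "t < s"
        using t s by simp
      hence sums: "(\<lambda>i. a i w * z ^ i) sums 0"
        using conj_seriesD(3)[OF assms z(1)] z by (simp add: z_def)
      have le_geo: "norm (a i w * z ^ i) \<le> C * x ^ i" for i
      proof -
        have "norm (a i w * z ^ i) \<le> C / s ^ i * t ^ i"
          unfolding norm_mult norm_power z by (intro mult_right_mono C) (use w \<open>t < s\<close> t in auto)
        thus ?thesis
          by (simp add: x_def power_divide)
      qed
      have geo: "(\<lambda>i. C * x ^ (i + Suc l)) sums (C * x ^ Suc l * (1 / (1 - x)))"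
        using sums_mult[OF geometric_sums, of x "C * x ^ Suc l"] x by (simp add: power_add mult_ac)
      have "(\<lambda>i. a (i + Suc l) w * z ^ (i + Suc l)) sums (0 - (\<Sum>i<Suc l. a i w * z ^ i))"
        using sums by (rule sums_split_initial_segment)
      hence "norm (0 - (\<Sum>i<Suc l. a i w * z ^ i)) = norm (\<Sum>i. a (i + Suc l) w * z ^ (i + Suc l))"
        by (simp only: sums_iff)
      also have "\<dots> \<le> (\<Sum>i. C * x ^ (i + Suc l))"
        using geo by (intro norm_suminf_le le_geo) (simp only: sums_iff)
      also have "\<dots> = C * x ^ Suc l * (1 / (1 - x))"
        using geo by (simp only: sums_iff)
      also have "\<dots> \<le> C * x ^ Suc l * 2"
        using x C by (intro mult_left_mono) (auto simp: field_simps)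
      finally have "norm (\<Sum>i\<le>l. a i w * z ^ i) \<le> 2 * C * x ^ Suc l"
        by (simp add: lessThan_Suc_atMost mult_ac)
      moreover have "P w = w ^ l * (\<Sum>i\<le>l. a i w * z ^ i)"
        unfolding P_def sum_distrib_left
      proof (rule sum.cong)
        fix i assume "i \<in> {..l}"
        hence "w ^ l = w ^ (l - i) * w ^ i"
          by (simp flip: power_add)
        moreover have "of_real (t ^ (2 * i)) = z ^ i * w ^ i"
          using zw by (simp add: power_mult flip: power_mult_distrib)
        ultimately show "a i w * of_real (t ^ (2 * i)) * w ^ (l - i) = w ^ l * (a i w * z ^ i)"
          by simp
      qed simp
      ultimately show ?thesis
        using t w by (simp add: norm_mult norm_power mult_left_mono)
    qed
    have P0: "norm (P 0) \<le> t ^ l * (2 * C * x ^ Suc l)"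
    proof (rule maximum_modulus_frontier[where f = P and S = "ball 0 t" and \<xi> = 0])
      show "P holomorphic_on interior (ball 0 t)"
        using hol by (rule holomorphic_on_subset) (use t in auto)
      show "continuous_on (closure (ball 0 t)) P"
        using holomorphic_on_imp_continuous_on[OF hol]
        by (rule continuous_on_subset) (use t in auto)
    qed (use t bound in auto)
    have "P 0 = (\<Sum>i\<le>l. if i = l then a l 0 * of_real (t ^ (2 * l)) else 0)"
      unfolding P_def by (rule sum.cong) auto
    also have "\<dots> = a l 0 * of_real (t ^ (2 * l))"
      by simp
    finally have "P 0 = a l 0 * of_real (t ^ (2 * l))" .
    hence "norm (P 0) = norm (a l 0) * (t ^ l * t ^ l)"
      using t by (simp only: norm_mult norm_of_real mult_2 power_add) simp
    \<comment> \<open>The tail starts at order l + 1, so the bound for P 0 exceeds the order t^(2 l)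
      by one factor t, which may tend to 0.\<close>
    moreover have "t ^ l * (2 * C * x ^ Suc l) = 2 * C / s ^ Suc l * t * (t ^ l * t ^ l)"
      unfolding x_def power_divide power_Suc[of t] by simp
    ultimately have "norm (a l 0) * (t ^ l * t ^ l) \<le> 2 * C / s ^ Suc l * t * (t ^ l * t ^ l)"
      using P0 by (simp only:)
    thus ?thesis
      by (rule mult_right_le_imp_le) (use t in simp)
  qed
  have "((\<lambda>t. 2 * C / s ^ Suc l * t) \<longlongrightarrow> 2 * C / s ^ Suc l * 0) (at_right 0)"
    by (intro tendsto_intros)
  moreover have "eventually (\<lambda>t. norm (a l 0) \<le> 2 * C / s ^ Suc l * t) (at_right 0)"
  proof (rule eventually_mono)
    show "eventually (\<lambda>t. t \<in> {0<..<s / 2}) (at_right 0)"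
      using s by (intro eventually_at_right_real) simp
  qed (rule le; simp)
  ultimately have "norm (a l 0) \<le> 2 * C / s ^ Suc l * 0"
    by (rule tendsto_lowerbound) simp
  thus ?thesis
    by simp
qed

text \<open>Cauchy product. A coefficient of index k has k + 1 summands, and k + 1 \<le> 2^k is
  absorbed by halving the radius.\<close>

lemma conj_series_mult_powser:
  assumes a: "conj_series s a F"
    and e: "\<And>i. norm (e i) \<le> E / s ^ i" "\<And>z. norm z < s \<Longrightarrow> (\<lambda>i. e i * z ^ i) sums G z"
  shows "conj_series (s / 2) (\<lambda>k w. \<Sum>i\<le>k. e i * a (k - i) w) (\<lambda>z. G z * F z)"
proof -
  have s: "s > 0"
    using conj_seriesD(1)[OF a] .
  obtain C where C: "C \<ge> 0" "\<And>i w. w \<in> ball 0 s \<Longrightarrow> norm (a i w) \<le> C / s ^ i"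
    by (rule conj_series_bound[OF a]) (rule that)
  have "E \<ge> 0"
    using order.trans[OF norm_ge_zero e(1)[of 0]] by simp
  show ?thesis
  proof (rule conj_seriesI)
    show "s / 2 > 0"
      using s by simp
    show "(\<lambda>w. \<Sum>i\<le>k. e i * a (k - i) w) holomorphic_on ball 0 (s / 2)" for k
      by (intro holomorphic_intros holomorphic_on_subset[OF conj_seriesD(2)[OF a]]) (use s in auto)
  next
    fix k w assume "w \<in> ball (0::complex) (s / 2)"
    hence w: "w \<in> ball 0 s"
      using s by simp
    have "norm (\<Sum>i\<le>k. e i * a (k - i) w) \<le> (\<Sum>i\<le>k. E * C / s ^ k)"
    proof (rule sum_norm_le)
      fix i assume i: "i \<in> {..k}"
      have "norm (e i * a (k - i) w) \<le> E / s ^ i * (C / s ^ (k - i))"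
        unfolding norm_mult using w e(1)[of i] C \<open>E \<ge> 0\<close> s by (intro mult_mono) auto
      also have "\<dots> = E * C / s ^ k"
        using i by (simp flip: power_add)
      finally show "norm (e i * a (k - i) w) \<le> E * C / s ^ k" .
    qed
    also have "\<dots> = real (Suc k) * (E * C / s ^ k)"
      by simp
    also have "\<dots> \<le> 2 ^ k * (E * C / s ^ k)"
    proof (rule mult_right_mono)
      have "Suc k \<le> 2 ^ k"
        using less_exp[of k] by (simp add: Suc_le_eq)
      thus "real (Suc k) \<le> 2 ^ k"
        by (metis of_nat_le_iff of_nat_numeral of_nat_power)
    qed (use s C \<open>E \<ge> 0\<close> in auto)
    finally show "norm (\<Sum>i\<le>k. e i * a (k - i) w) \<le> (E * C) / (s / 2) ^ k"
      by (simp add: power_divide mult_ac)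
  next
    fix z :: complex assume "z \<noteq> 0" "norm z < s / 2"
    hence z: "z \<noteq> 0" "norm z < s"
      using s by auto
    define x where "x = norm z / s"
    have x: "0 \<le> x" "x < 1"
      using z s by (auto simp: x_def)
    have geo: "summable (\<lambda>i. K * x ^ i)" for K
      using x by (intro summable_mult summable_geometric) auto
    have e_le: "norm (e i * z ^ i) \<le> E * x ^ i" for i
      using mult_right_mono[OF e(1)[of i], of "norm z ^ i"]
      by (simp add: norm_mult norm_power x_def power_divide)
    have a_le: "norm (a i (cnj z) * z ^ i) \<le> C * x ^ i" for i
      using mult_right_mono[OF C(2)[of "cnj z" i], of "norm z ^ i"] z
      by (simp add: norm_mult norm_power x_def power_divide)
    have "(\<lambda>k. \<Sum>i\<le>k. (e i * z ^ i) * (a (k - i) (cnj z) * z ^ (k - i))) sums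
            ((\<Sum>i. e i * z ^ i) * (\<Sum>i. a i (cnj z) * z ^ i))"
      using e_le a_le
      by (intro Cauchy_product_sums summable_comparison_test[OF _ geo[of E]] summable_comparison_test[OF _ geo[of C]]) auto
    also have "(\<Sum>i. e i * z ^ i) * (\<Sum>i. a i (cnj z) * z ^ i) = G z * F z"
      using e(2)[OF z(2)] conj_seriesD(3)[OF a z] by (simp add: sums_iff)
    also have "(\<lambda>k. \<Sum>i\<le>k. (e i * z ^ i) * (a (k - i) (cnj z) * z ^ (k - i))) =
               (\<lambda>k. (\<Sum>i\<le>k. e i * a (k - i) (cnj z)) * z ^ k)"
    proof
      fix k
      have "(e i * z ^ i) * (a (k - i) (cnj z) * z ^ (k - i)) = e i * a (k - i) (cnj z) * z ^ k" if "i \<le> k" for i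
      proof -
        have "z ^ k = z ^ i * z ^ (k - i)"
          using that by (simp flip: power_add)
        thus ?thesis
          by simp
      qed
      thus "(\<Sum>i\<le>k. (e i * z ^ i) * (a (k - i) (cnj z) * z ^ (k - i))) = (\<Sum>i\<le>k. e i * a (k - i) (cnj z)) * z ^ k"
        unfolding sum_distrib_right by (intro sum.cong) auto
    qed
    finally show "(\<lambda>k. (\<Sum>i\<le>k. e i * a (k - i) (cnj z)) * z ^ k) sums (G z * F z)" .
  qed
qed

section \<open>Expansions multiplied by exp (\<beta> z^2)\<close>

definition exp_sq_coeff :: "complex \<Rightarrow> nat \<Rightarrow> complex" where
  "exp_sq_coeff \<beta> i = (if even i then \<beta> ^ (i div 2) / fact (i div 2) else 0)"

text \<open>Stated for arbitrary g because it serves twice: with powers of z it yields the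
  exponential series, with expansion coefficients it turns a Cauchy product into the series defining
  \<open>rho\<close>.\<close>

lemma sums_exp_sq_coeff_iff:
  "(\<lambda>i. exp_sq_coeff \<beta> i * g i) sums S \<longleftrightarrow> (\<lambda>j. \<beta> ^ j / fact j * g (2 * j)) sums S"
proof -
  have "(\<lambda>j. exp_sq_coeff \<beta> (2 * j) * g (2 * j)) sums S \<longleftrightarrow> (\<lambda>i. exp_sq_coeff \<beta> i * g i) sums S"
  proof (rule sums_mono_reindex)
    show "strict_mono (\<lambda>j::nat. 2 * j)"
      by (simp add: strict_mono_def)
    fix i :: nat assume "i \<notin> range (\<lambda>j. 2 * j)"
    hence "odd i"
      by (auto elim!: evenE)
    thus "exp_sq_coeff \<beta> i * g i = 0"
      by (simp add: exp_sq_coeff_def)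
  qed
  thus ?thesis
    by (simp add: exp_sq_coeff_def)
qed

lemma sums_exp_sq: "(\<lambda>i. exp_sq_coeff \<beta> i * z ^ i) sums exp (\<beta> * z\<^sup>2)"
  unfolding sums_exp_sq_coeff_iff using exp_converges[of "\<beta> * z\<^sup>2"]
  by (simp add: power_mult_distrib scaleR_conv_of_real field_simps flip: power_mult)

lemma exp_sq_coeff_bound:
  assumes "s > 0"
  obtains E where "\<And>i. norm (exp_sq_coeff \<beta> i) \<le> E / s ^ i"
proof -
  have "summable (\<lambda>i. exp_sq_coeff \<beta> i * of_real s ^ i)"
    using sums_exp_sq by (rule sums_summable)
  hence "Bseq (\<lambda>i. exp_sq_coeff \<beta> i * of_real s ^ i)"
    by (intro convergent_imp_Bseq) (auto intro: summable_LIMSEQ_zero simp: convergent_def)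
  then obtain E where "\<And>i. norm (exp_sq_coeff \<beta> i * of_real s ^ i) \<le> E"
    by (auto simp: Bseq_def)
  hence "norm (exp_sq_coeff \<beta> i) \<le> E / s ^ i" for i
    using assms by (simp add: norm_mult norm_power field_simps)
  thus ?thesis
    by (rule that)
qed

text \<open>
  The terms of a uniformly convergent series are eventually bounded on the circle \<open>norm z = s\<close>, and
  the maximum principle for the holomorphic coefficients carries this bound over to the disc. So
  the series is dominated by a geometric one, although its convergence is assumed for the
  antiholomorphic arguments \<open>w = cnj z\<close> only.
\<close>

lemma has_conj_expansion_coeff_bound:
  assumes r: "r > 0"
    and hol: "\<And>n. c n holomorphic_on ball 0 r"
    and lim: "\<And>K. compact K \<Longrightarrow> K \<subseteq> ball 0 r - {0} \<Longrightarrow>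
           uniform_limit K (\<lambda>M z. \<Sum>n\<in>{N..<N + int M}. c n (cnj z) * z powi n) f sequentially"
  obtains s C where "0 < s" "s < r" "\<And>i w. w \<in> ball 0 s \<Longrightarrow> norm (c (N + int i) w) \<le> C / s ^ i"
proof -
  define s where "s = r / 2"
  have s: "0 < s" "s < r"
    using r by (auto simp: s_def)
  define S where "S = (\<lambda>M z. \<Sum>n\<in>{N..<N + int M}. c n (cnj z) * z powi n)"
  have "uniform_limit (sphere 0 s) S f sequentially"
    unfolding S_def using s by (intro lim) auto
  hence "eventually (\<lambda>M. \<forall>z\<in>sphere 0 s. dist (S M z) (f z) < 1) sequentially"
    by (rule uniform_limitD) simp
  then obtain M0 where "\<forall>M\<ge>M0. \<forall>z\<in>sphere 0 s. dist (S M z) (f z) < 1"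
    unfolding eventually_sequentially by metis
  hence M0: "dist (S M z) (f z) < 1" if "M \<ge> M0" "norm z = s" for M z
    using that by simp
  have max_mod: "norm (c n w) \<le> B" if "\<And>w. norm w = s \<Longrightarrow> norm (c n w) \<le> B" "w \<in> ball 0 s" for n w B
  proof (rule maximum_modulus_frontier[where f = "c n" and S = "ball 0 s" and \<xi> = w])
    show "c n holomorphic_on interior (ball 0 s)"
      using hol by (rule holomorphic_on_subset) (use s in auto)
    show "continuous_on (closure (ball 0 s)) (c n)"
      using holomorphic_on_imp_continuous_on[OF hol] by (rule continuous_on_subset) (use s in auto)
  qed (use s that in auto)
  have large: "norm (c (N + int i) w) \<le> 2 * s powi (- N) / s ^ i" if i: "i \<ge> M0" and w: "w \<in> ball 0 s" for i w
  proof (rule max_mod[OF _ w])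
    fix w :: complex assume w: "norm w = s"
    define z where "z = cnj w"
    have "norm z = s"
      using w by (simp add: z_def)
    \<comment> \<open>A single term is the difference of two consecutive partial sums, each within
      distance 1 of f; hence the bound 2.\<close>
    have "{N..<N + int (Suc i)} = insert (N + int i) {N..<N + int i}"
      by auto
    hence "c (N + int i) w * z powi (N + int i) = S (Suc i) z - S i z"
      by (simp add: S_def z_def)
    also have "norm \<dots> \<le> dist (S (Suc i) z) (f z) + dist (S i z) (f z)"
      unfolding dist_norm[symmetric] by (rule dist_triangle2)
    also have "\<dots> \<le> 2"
      using M0[of i z] M0[of "Suc i" z] i \<open>norm z = s\<close> by simp
    finally have "norm (c (N + int i) w) * s powi (N + int i) \<le> 2"
      by (simp add: norm_mult norm_power_int \<open>norm z = s\<close>)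
    hence "norm (c (N + int i) w) \<le> 2 / s powi (N + int i)"
      using s by (simp add: pos_le_divide_eq)
    also have "\<dots> = 2 * s powi (- N) / s ^ i"
      using s by (simp add: power_int_add power_int_minus field_simps)
    finally show "norm (c (N + int i) w) \<le> 2 * s powi (- N) / s ^ i" .
  qed
  have "\<exists>B. \<forall>w\<in>ball 0 s. norm (c n w) \<le> B" for n
  proof -
    have "continuous_on (cball 0 s) (c n)"
      using holomorphic_on_imp_continuous_on[OF hol] by (rule continuous_on_subset) (use s in auto)
    hence "bounded (c n ` cball 0 s)"
      by (intro compact_imp_bounded compact_continuous_image) auto
    then obtain B where "\<forall>w\<in>cball 0 s. norm (c n w) \<le> B"
      by (auto simp: bounded_iff)
    thus ?thesis
      by (intro exI[of _ B]) auto
  qed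
  then obtain B where B: "\<And>n w. w \<in> ball 0 s \<Longrightarrow> norm (c n w) \<le> B n"
    by metis
  define C where "C = Max (insert (2 * s powi (- N)) ((\<lambda>i. B (N + int i) * s ^ i) ` {..<M0}))"
  have "norm (c (N + int i) w) \<le> C / s ^ i" if w: "w \<in> ball 0 s" for i w
  proof (cases "i < M0")
    case True
    have "norm (c (N + int i) w) * s ^ i \<le> B (N + int i) * s ^ i"
      using s w by (intro mult_right_mono B) auto
    also have "\<dots> \<le> C"
      using True by (auto simp: C_def intro!: Max_ge)
    finally show ?thesis
      using s by (simp add: pos_le_divide_eq)
  next
    case False
    have "norm (c (N + int i) w) \<le> 2 * s powi (- N) / s ^ i"
      by (rule large) (use False w in auto)
    also have "\<dots> \<le> C / s ^ i"
      using s by (intro divide_right_mono) (auto simp: C_def intro!: Max_ge)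
    finally show ?thesis .
  qed
  with s show ?thesis
    by (rule that)
qed

lemma has_conj_expansion_imp_conj_series:
  assumes "has_conj_expansion f c"
  obtains N0 where "\<And>n. n < N0 \<Longrightarrow> c n 0 = 0"
    "\<And>N. N \<le> N0 \<Longrightarrow> \<exists>s. conj_series s (\<lambda>i. c (N + int i)) (\<lambda>z. f z / z powi N)"
proof -
  from assms obtain r N0 where r: "r > 0" and hol': "\<forall>n. c n holomorphic_on ball 0 r"
    and zero': "\<forall>n<N0. \<forall>w\<in>ball 0 r. c n w = 0"
    and lim': "\<forall>K. compact K \<and> K \<subseteq> ball 0 r - {0} \<longrightarrow>
           uniform_limit K (\<lambda>M z. \<Sum>n\<in>{N0..<N0 + int M}. c n (cnj z) * z powi n) f sequentially"
    unfolding has_conj_expansion_def by (elim exE conjE)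
  note hol = hol'[rule_format] and zero = zero'[rule_format] and lim = lim'[rule_format, OF conjI]
  have sums: "(\<lambda>i. c (N + int i) (cnj z) * z powi (N + int i)) sums f z"
    if "N \<le> N0" "z \<noteq> 0" "norm z < r" for N z
  proof -
    define p where "p = nat (N0 - N)"
    have N: "N + int (i + p) = N0 + int i" for i
      using that by (simp add: p_def)
    have "(\<lambda>M. \<Sum>n\<in>{N0..<N0 + int M}. c n (cnj z) * z powi n) \<longlonglongrightarrow> f z"
      by (rule tendsto_uniform_limitI[OF lim[of "{z}"]]) (use that in auto)
    also have "(\<lambda>M. \<Sum>n\<in>{N0..<N0 + int M}. c n (cnj z) * z powi n) =
               (\<lambda>M. \<Sum>i<M. c (N0 + int i) (cnj z) * z powi (N0 + int i))"
    proof
      fix M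
      show "(\<Sum>n\<in>{N0..<N0 + int M}. c n (cnj z) * z powi n) = (\<Sum>i<M. c (N0 + int i) (cnj z) * z powi (N0 + int i))"
        by (rule sum.reindex_bij_witness[of _ "\<lambda>i. N0 + int i" "\<lambda>n. nat (n - N0)"]) auto
    qed
    finally have "(\<lambda>i. c (N0 + int i) (cnj z) * z powi (N0 + int i)) sums f z"
      unfolding sums_def .
    hence "(\<lambda>i. c (N + int (i + p)) (cnj z) * z powi (N + int (i + p))) sums f z"
      unfolding N .
    moreover have "c (N + int i) (cnj z) * z powi (N + int i) = 0" if "i < p" for i
      using zero[of "N + int i" "cnj z"] that \<open>norm z < r\<close> by (simp add: p_def)
    ultimately show ?thesis
      using sums_zero_iff_shift[of p "\<lambda>i. c (N + int i) (cnj z) * z powi (N + int i)" "f z"] by simp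
  qed
  show ?thesis
  proof
    show "c n 0 = 0" if "n < N0" for n
      using zero that r by simp
    fix N assume "N \<le> N0"
    show "\<exists>s. conj_series s (\<lambda>i. c (N + int i)) (\<lambda>z. f z / z powi N)"
    proof -
      obtain s C where s: "0 < s" "s < r" and
        C: "\<And>i w. w \<in> ball 0 s \<Longrightarrow> norm (c (N0 + int i) w) \<le> C / s ^ i"
        using has_conj_expansion_coeff_bound[OF r hol lim] by blast
      have "C \<ge> 0"
        using order.trans[OF norm_ge_zero C[of 0 0]] s by simp
      define p where "p = nat (N0 - N)"
      have bound: "norm (c (N + int i) w) \<le> C * s ^ p / s ^ i" if w: "w \<in> ball 0 s" for i w
      proof (cases "i < p")
        case True
        have "c (N + int i) w = 0"
          by (rule zero) (use True w s in \<open>auto simp: p_def\<close>)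
        thus ?thesis
          using s \<open>C \<ge> 0\<close> by simp
      next
        case False
        hence "N + int i = N0 + int (i - p)"
          using \<open>N \<le> N0\<close> by (simp add: p_def)
        moreover have "C / s ^ (i - p) = C * s ^ p / s ^ i"
          using False s by (simp add: power_diff)
        ultimately show ?thesis
          using C[OF w, of "i - p"] by simp
      qed
      have "conj_series s (\<lambda>i. c (N + int i)) (\<lambda>z. f z / z powi N)"
      proof (rule conj_seriesI[where C = "C * s ^ p"])
        show "c (N + int i) holomorphic_on ball 0 s" for i
          using hol by (rule holomorphic_on_subset) (use s in auto)
        show "(\<lambda>i. c (N + int i) (cnj z) * z ^ i) sums (f z / z powi N)" if z: "z \<noteq> 0" "norm z < s" for z
          using sums_divide[OF sums[OF \<open>N \<le> N0\<close> z(1)], of "z powi N"] z s by (simp add: power_int_add)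
      qed (use s bound in auto)
      thus ?thesis ..
    qed
  qed
qed

lemma has_conj_expansion_exp_sq:
  assumes "has_conj_expansion f c"
  obtains N0 where "\<And>N. N \<le> N0 \<Longrightarrow> \<exists>s b. conj_series s b (\<lambda>z. exp (\<beta> * z\<^sup>2) * (f z / z powi N)) \<and>
                     (\<forall>k. b k 0 = (\<Sum>j. \<beta> ^ j / fact j * c (N + int k - 2 * int j) 0))"
proof -
  obtain N0 where zero: "\<And>n. n < N0 \<Longrightarrow> c n 0 = 0"
    and series: "\<And>N. N \<le> N0 \<Longrightarrow> \<exists>s. conj_series s (\<lambda>i. c (N + int i)) (\<lambda>z. f z / z powi N)"
    by (rule has_conj_expansion_imp_conj_series[OF assms]) (rule that)
  show ?thesis
  proof (rule that)
    fix N assume N: "N \<le> N0"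
    from series[OF N] obtain s where s: "conj_series s (\<lambda>i. c (N + int i)) (\<lambda>z. f z / z powi N)"
      by blast
    obtain E where E: "\<And>i. norm (exp_sq_coeff \<beta> i) \<le> E / s ^ i"
      by (rule exp_sq_coeff_bound[OF conj_seriesD(1)[OF s], of \<beta>]) (rule that)
    define b where "b = (\<lambda>k w. \<Sum>i\<le>k. exp_sq_coeff \<beta> i * c (N + int (k - i)) w)"
    have "conj_series (s / 2) b (\<lambda>z. exp (\<beta> * z\<^sup>2) * (f z / z powi N))"
      unfolding b_def by (rule conj_series_mult_powser[OF s E sums_exp_sq])
    moreover have "b k 0 = (\<Sum>j. \<beta> ^ j / fact j * c (N + int k - 2 * int j) 0)" for k
    proof -
      \<comment> \<open>For i > k the exponent N + k - i lies below N0, so the infinite series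
        reduces to the finite Cauchy sum.\<close>
      have "(\<lambda>i. exp_sq_coeff \<beta> i * c (N + int k - int i) 0) sums
              (\<Sum>i\<le>k. exp_sq_coeff \<beta> i * c (N + int k - int i) 0)"
        using N by (intro sums_finite) (auto intro!: zero)
      also have "(\<Sum>i\<le>k. exp_sq_coeff \<beta> i * c (N + int k - int i) 0) = b k 0"
        unfolding b_def by (rule sum.cong) (auto simp: of_nat_diff algebra_simps)
      finally show ?thesis
        unfolding sums_exp_sq_coeff_iff[where g = "\<lambda>i. c (N + int k - int i) 0"]
        by (simp add: sums_iff)
    qed
    ultimately show "\<exists>s b. conj_series s b (\<lambda>z. exp (\<beta> * z\<^sup>2) * (f z / z powi N)) \<and>
                     (\<forall>k. b k 0 = (\<Sum>j. \<beta> ^ j / fact j * c (N + int k - 2 * int j) 0))"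
      by blast
  qed
qed

section \<open>Comparison of coefficients\<close>

theorem proposition3p2:
  fixes \<phi> :: "complex \<Rightarrow> complex \<Rightarrow> complex"
    and chi :: "int \<Rightarrow> complex \<Rightarrow> complex \<Rightarrow> complex"
    and k m :: nat and n :: int
  assumes "transforms_jacobi k m \<phi>"
    and "\<And>\<tau>. \<tau> \<in> \<H> \<Longrightarrow> has_conj_expansion (\<lambda>z. \<phi> z \<tau>) (\<lambda>i w. chi i w \<tau>)"
  shows "transforms_modular (int k + n) (rho m chi n)"
  unfolding transforms_modular_def
proof clarify
  fix a b c d :: int and \<tau> :: complex
  assume abcd: "(a, b, c, d) \<in> SL2Z" and \<tau>: "\<tau> \<in> \<H>"
  define J where "J = aut_factor c d \<tau>"
  define \<tau>' where "\<tau>' = moebius a b c d \<tau>"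
  define \<beta> where "\<beta> = (\<lambda>\<tau>. of_real pi ^ 2 * of_nat m / 3 * E2 \<tau>)"
  have Im: "Im \<tau> > 0"
    using \<tau> by (simp add: upper_half_plane_def)
  have J: "J \<noteq> 0"
    unfolding J_def using abcd Im by (rule aut_factor_nonzero)
  hence \<tau>': "\<tau>' \<in> \<H>"
    using Im_moebius[OF abcd, of \<tau>] Im by (simp add: upper_half_plane_def \<tau>'_def J_def)
  have \<phi>: "\<phi> (z / J) \<tau>' = J ^ k * exp (2 * of_real pi * \<i> * of_nat m * of_int c * z\<^sup>2 / J) * \<phi> z \<tau>" for z
    using assms(1) abcd \<tau> unfolding transforms_jacobi_def J_def \<tau>'_def by blast
  have "\<beta> \<tau>' = J\<^sup>2 * (\<beta> \<tau> - 2 * of_real pi * \<i> * of_nat m * of_int c / J)"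
    using J unfolding \<beta>_def \<tau>'_def E2_moebius[OF abcd Im] J_def[symmetric]
    by (simp add: field_simps power2_eq_square)
  hence exponent: "\<beta> \<tau>' * (z / J)\<^sup>2 + 2 * of_real pi * \<i> * of_nat m * of_int c * z\<^sup>2 / J = \<beta> \<tau> * z\<^sup>2" for z
    using J by (simp add: power_divide left_diff_distrib)

  obtain N0 where N0: "\<And>N. N \<le> N0 \<Longrightarrow> \<exists>s b. conj_series s b (\<lambda>z. exp (\<beta> \<tau> * z\<^sup>2) * (\<phi> z \<tau> / z powi N)) \<and>
      (\<forall>k. b k 0 = (\<Sum>j. \<beta> \<tau> ^ j / fact j * chi (N + int k - 2 * int j) 0 \<tau>))"
    by (rule has_conj_expansion_exp_sq[OF assms(2)[OF \<tau>], of "\<beta> \<tau>"]) (rule that)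
  obtain N1 where N1: "\<And>N. N \<le> N1 \<Longrightarrow> \<exists>s b. conj_series s b (\<lambda>z. exp (\<beta> \<tau>' * z\<^sup>2) * (\<phi> z \<tau>' / z powi N)) \<and>
      (\<forall>k. b k 0 = (\<Sum>j. \<beta> \<tau>' ^ j / fact j * chi (N + int k - 2 * int j) 0 \<tau>'))"
    by (rule has_conj_expansion_exp_sq[OF assms(2)[OF \<tau>'], of "\<beta> \<tau>'"]) (rule that)
  \<comment> \<open>Admissible for both expansions, and at most n, so that n = N + l with a natural
    number l.\<close>
  define N where "N = min n (min N0 N1)"
  define l where "l = nat (n - N)"
  have n: "n = N + int l"
    by (simp add: l_def N_def)
  have "N \<le> N0"
    by (simp add: N_def)
  from N0[OF this] obtain s p where p: "conj_series s p (\<lambda>z. exp (\<beta> \<tau> * z\<^sup>2) * (\<phi> z \<tau> / z powi N))"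
    and "\<forall>k. p k 0 = (\<Sum>j. \<beta> \<tau> ^ j / fact j * chi (N + int k - 2 * int j) 0 \<tau>)"
    by blast
  hence p0: "p l 0 = rho m chi n \<tau>"
    unfolding n rho_def \<beta>_def by blast
  have "N \<le> N1"
    by (simp add: N_def)
  from N1[OF this] obtain s' p' where p': "conj_series s' p' (\<lambda>z. exp (\<beta> \<tau>' * z\<^sup>2) * (\<phi> z \<tau>' / z powi N))"
    and "\<forall>k. p' k 0 = (\<Sum>j. \<beta> \<tau>' ^ j / fact j * chi (N + int k - 2 * int j) 0 \<tau>')"
    by blast
  hence p0': "p' l 0 = rho m chi n \<tau>'"
    unfolding n rho_def \<beta>_def by blast
  \<comment> \<open>Coefficients of the difference of the two sides of the completed law;
    \<open>J powi (- N)\<close> compensates for dividing by \<open>(z / J) powi N\<close> instead of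
    \<open>z powi N\<close>.\<close>
  define h where "h = (\<lambda>i w. J ^ k * p i w - J powi (- N) * (p' i (w / cnj J) / J ^ i))"
  have "conj_series (min s (s' * norm J)) h (\<lambda>_. 0)"
    unfolding h_def
  proof (rule conj_series_cong[OF conj_series_diff[OF conj_series_cmult[OF p] conj_series_cmult[OF conj_series_scale[OF p' J]]]])
    fix z :: complex assume "z \<noteq> 0"
    have "exp (\<beta> \<tau>' * (z / J)\<^sup>2) * (\<phi> (z / J) \<tau>' / (z / J) powi N) =
            J ^ k * J powi N * (exp (\<beta> \<tau> * z\<^sup>2) * (\<phi> z \<tau> / z powi N))"
      unfolding \<phi> exponent[of z, symmetric] exp_add by (simp add: power_int_divide_distrib)
    moreover have "J powi (- N) * J powi N = 1"
      using J by (simp add: power_int_minus)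
    ultimately show "J ^ k * (exp (\<beta> \<tau> * z\<^sup>2) * (\<phi> z \<tau> / z powi N)) -
        J powi (- N) * (exp (\<beta> \<tau>' * (z / J)\<^sup>2) * (\<phi> (z / J) \<tau>' / (z / J) powi N)) = 0"
      by (simp add: mult.left_commute[of "J powi (- N)"] mult_ac)
  qed
  hence "h l 0 = 0"
    by (rule conj_series_zero_imp_coeff_zero)
  \<comment> \<open>The weight k + n is collected from J^k of the Jacobi law, J^N of the
    normalisation and J^l of the rescaled coefficient.\<close>
  hence "J powi (- N) * (rho m chi n \<tau>' / J ^ l) = J ^ k * rho m chi n \<tau>"
    by (simp add: h_def p0 p0')
  hence "rho m chi n \<tau>' = J ^ k * J powi N * J ^ l * rho m chi n \<tau>"
    using J by (simp add: power_int_minus field_simps)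
  also have "J ^ k * J powi N * J ^ l = J powi (int k + n)"
    using J by (simp add: n power_int_add)
  finally show "rho m chi n (moebius a b c d \<tau>) = aut_factor c d \<tau> powi (int k + n) * rho m chi n \<tau>"
    by (simp add: \<tau>'_def J_def)
qed

end
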